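(* Let $\{h_n\}_{n\ge1}$ be a bandwidth sequence satisfying assumption (B), and let $\{h_n^*\}_{n\ge 1}$ be a sequence with $\lim_{n\to\infty}h_n^*=0$ and $h_n^*\ge n^{-d_0}$ for some $d_0<\frac{1}{2d}$. Assume (A1), (C1) and (C2). Then, with probability $1$, $$\lim_{n\to\infty}\Big\{R\big(\widehat{NN}_{S_C,h_n^*}\big)-\frac{1}{n^2}\sum_{1\le l<m\le n}\theta_{lm}H_{lm}\Big\}=0,$$ where $$H_{lm}=K_{h_n}(X_l-X_m)\left(\frac{1}{\hat f_{n,h_n}(X_l)}+\frac{1}{\hat f_{n,h_n}(X_m)}\right)$$ and $\theta_{lm}=\mathbf 1_{\{Y_l\ne Y_m\}}$ (so $\theta_{lm}=1$ if $X_l$ and $X_m$ belong to different classes and $0$ otherwise).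
   Context: Setting: $(X,Y)$ is a random couple with $X\in\mathcal X\subset[-M_0,M_0]^d\subset\mathbb R^d$ and $Y\in\{1,\dots,Q\}$; $(X_1,Y_1),(X_2,Y_2),\dots$ are i.i.d. copies of $(X,Y)$. $f$ is the density of $X$, $\eta^{(i)}(x)=P[Y=i\mid X=x]$, $\pi^{(i)}=P[Y=i]$ and $f^{(i)}$ is the class-conditional density of class $i$, so $f=\sum_i\pi^{(i)}f^{(i)}$; all these functions are measurable. $S_C$ denotes the training data $\{(X_l,Y_l)\}_{l=1}^n$ (equivalently the labelled partition $\{(C_i,i)\}_{i=1}^Q$, $C_i=\{X_l:Y_l=i\}$). Kernel: $K(x)=(2\pi)^{-d/2}e^{-\|x\|^2/2}$, $K_h(x)=h^{-d}K(x/h)$. Kernel density estimator: $\hat f_{n,h}(x)=\frac1n\sum_{l=1}^nK_h(x-X_l)$. Soft nearest-neighbor rule: $\widehat{NN}_{S_C,h^*}(x,i)=\dfrac{\sum_{l=1}^nK_{h^*}(x-X_l)\mathbf 1_{\{Y_l=i\}}}{\sum_{l=1}^nK_{h^*}(x-X_l)}$ is the probability that $x$ is assigned to class $i$ by the rule. Its misclassification error, for fixed training data $S_C$, is $R(\widehat{NN}_{S_C,h^*})=\sum_{i,j\in\{1,\dots,Q\},\,i\ne j}\mathbb E_X\big[\eta^{(i)}(X)\,\widehat{NN}_{S_C,h^*}(X,j)\big]$, the expectation being over a new $X$ only. Assumptions: (A1) $0<f_{\min}\le f\le f_{\max}$. (C1) $0<f^{(i)}_{\min}\le f^{(i)}\le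 f^{(i)}_{\max}$ for $1\le i\le Q$. (C2) There are $\gamma>0$ and constants $c_i$ with $|f^{(i)}(x)-f^{(i)}(y)|\le c_i\|x-y\|^\gamma$ for all $x,y$ and $1\le i\le Q$. (B) $h_n\searrow0$; $\frac{-\log h_n}{nh_n^{d+2\gamma}}\to0$; $\frac{-\log h_n}{\log\log n}\to\infty$; and $h_n^d<a\,h_{2n}^d$ for some $a>0$. *)

theory Defs
  imports "HOL-Probability.Probability"
begin

text \<open>
  Samples are passed to the estimators below as plain sequences \<open>x l\<close>, \<open>y l\<close>, of which only
  the terms with index \<open>1, \<dots>, n\<close> are used; the randomness enters when they are instantiated
  with \<open>\<lambda>l. X l \<omega>\<close> and \<open>\<lambda>l. Y l \<omega>\<close>.
\<close>

definition gauss_kernel :: "real ^ 'd \<Rightarrow> real" where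
  "gauss_kernel u = (2 * pi) powr (- real CARD('d) / 2) * exp (- (norm u)\<^sup>2 / 2)"

definition scaled_kernel :: "real \<Rightarrow> real ^ 'd \<Rightarrow> real" where
  "scaled_kernel h u = gauss_kernel (u /\<^sub>R h) / h ^ CARD('d)"

definition kde :: "(nat \<Rightarrow> real ^ 'd) \<Rightarrow> nat \<Rightarrow> real \<Rightarrow> real ^ 'd \<Rightarrow> real" where
  "kde x n h u = (1 / real n) * (\<Sum>l=1..n. scaled_kernel h (u - x l))"

definition soft_nn ::
  "(nat \<Rightarrow> real ^ 'd) \<Rightarrow> (nat \<Rightarrow> nat) \<Rightarrow> nat \<Rightarrow> real \<Rightarrow> real ^ 'd \<Rightarrow> nat \<Rightarrow> real" where
  "soft_nn x y n h u i =
     (\<Sum>l=1..n. scaled_kernel h (u - x l) * of_bool (y l = i)) /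
     (\<Sum>l=1..n. scaled_kernel h (u - x l))"

text \<open>
  The training data \<open>x\<close>, \<open>y\<close> are fixed here: the expectation is over the new point \<open>X\<close> only.
\<close>

definition soft_nn_risk ::
  "'a measure \<Rightarrow> ('a \<Rightarrow> real ^ 'd) \<Rightarrow> nat \<Rightarrow> (nat \<Rightarrow> real ^ 'd \<Rightarrow> real) \<Rightarrow>
   (nat \<Rightarrow> real ^ 'd) \<Rightarrow> (nat \<Rightarrow> nat) \<Rightarrow> nat \<Rightarrow> real \<Rightarrow> real" where
  "soft_nn_risk M X Q \<eta> x y n h =
     (\<Sum>i\<in>{1..Q}. \<Sum>j\<in>{1..Q} - {i}. \<integral>\<omega>. \<eta> i (X \<omega>) * soft_nn x y n h (X \<omega>) j \<partial>M)"

definition theta :: "(nat \<Rightarrow> nat) \<Rightarrow> nat \<Rightarrow> nat \<Rightarrow> real" where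
  "theta y l m = of_bool (y l \<noteq> y m)"

definition pair_weight :: "(nat \<Rightarrow> real ^ 'd) \<Rightarrow> nat \<Rightarrow> real \<Rightarrow> nat \<Rightarrow> nat \<Rightarrow> real" where
  "pair_weight x n h l m =
     scaled_kernel h (x l - x m) * (1 / kde x n h (x l) + 1 / kde x n h (x m))"

text \<open>Real-valued (everywhere nonnegative) Lebesgue density of \<open>X\<close> under \<open>M\<close>.\<close>

definition real_density_of :: "'a measure \<Rightarrow> ('a \<Rightarrow> real ^ 'd) \<Rightarrow> (real ^ 'd \<Rightarrow> real) \<Rightarrow> bool" where
  "real_density_of M X f \<longleftrightarrow>
     f \<in> borel_measurable borel \<and> (\<forall>u. 0 \<le> f u) \<and> distributed M lborel X (\<lambda>u. ennreal (f u))"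

text \<open>
  The law of \<open>X\<close> given \<open>Y = i\<close> is its law under \<open>M\<close> conditioned on the event \<open>{Y = i}\<close>.  If that
  event is null, the conditioned measure is the zero measure, so that a density which is positive
  on the support of \<open>X\<close> exists only if the event has positive probability.
\<close>

definition class_density_of ::
  "'a measure \<Rightarrow> ('a \<Rightarrow> real ^ 'd) \<Rightarrow> ('a \<Rightarrow> nat) \<Rightarrow> nat \<Rightarrow> (real ^ 'd \<Rightarrow> real) \<Rightarrow> bool" where
  "class_density_of M X Y i g \<longleftrightarrow>
     real_density_of (uniform_measure M {\<omega> \<in> space M. Y \<omega> = i}) X g"

text \<open>\<open>g\<close> is a measurable version of \<open>u \<mapsto> P[Y = i | X = u]\<close>, that is, \<open>g(X) = P[Y = i | \<sigma>(X)]\<close> a.s.\<close>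

definition class_posterior_of ::
  "'a measure \<Rightarrow> ('a \<Rightarrow> real ^ 'd) \<Rightarrow> ('a \<Rightarrow> nat) \<Rightarrow> nat \<Rightarrow> (real ^ 'd \<Rightarrow> real) \<Rightarrow> bool" where
  "class_posterior_of M X Y i g \<longleftrightarrow>
     g \<in> borel_measurable borel \<and>
     (AE \<omega> in M. g (X \<omega>) =
        real_cond_exp M (vimage_algebra (space M) X borel)
          (indicator {\<omega> \<in> space M. Y \<omega> = i}) \<omega>)"

text \<open>Bandwidths are indexed from \<open>1\<close>; \<open>h 0\<close> is irrelevant.\<close>

definition bandwidth_condition :: "nat \<Rightarrow> real \<Rightarrow> (nat \<Rightarrow> real) \<Rightarrow> bool" where
  "bandwidth_condition d \<gamma> h \<longleftrightarrow>
     (\<forall>n\<ge>1. 0 < h n) \<and> antimono_on {1..} h \<and> h \<longlonglongrightarrow> 0 \<and>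
     (\<lambda>n. - ln (h n) / (real n * h n powr (real d + 2 * \<gamma>))) \<longlonglongrightarrow> 0 \<and>
     filterlim (\<lambda>n. - ln (h n) / ln (ln (real n))) at_top sequentially \<and>
     (\<exists>a>0. \<forall>n\<ge>1. h n ^ d < a * h (2 * n) ^ d)"

end

theory Submission
  imports Defs "HOL-Real_Asymp.Real_Asymp"
begin

text \<open>
  Both terms converge almost surely to the asymptotic nearest-neighbour risk
  \<open>\<Sum>\<^sub>i\<^sub>\<noteq>\<^sub>j E[\<eta>\<^sub>i(X) \<eta>\<^sub>j(X)]\<close>. The pairwise sum is the resubstitution error of the soft
  nearest-neighbour rule, that is, its error averaged over the training points themselves.
  Gaussian smoothing is an \<open>L\<^sup>1\<close> approximate identity, so for a small bandwidth the smoothed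
  functions \<open>\<eta>\<^sub>j f\<close> are uniformly close to the original ones outside a set of points of small
  probability. At a fixed point outside this set a
  Bernstein inequality bounds the probability that the kernel sums deviate from their means by
  \<open>exp (- c n h\<^sup>d)\<close>, and both bandwidths satisfy \<open>n h\<^sup>d \<ge> n\<^sup>\<beta>\<close> for some \<open>\<beta> > 0\<close>. Fubini's theorem
  (for the risk), respectively independence and a union bound (for the resubstitution error), and
  the Borel--Cantelli lemma finish the proof.
\<close>

section \<open>Continuity of translation in the mean\<close>

text \<open>The obstacle is the boundary of the support. There \<open>f\<close> drops from at least
  \<open>fmin\<close> to zero, so a Gaussian average straddling the edge keeps a bias however small
  the bandwidth is, and closeness uniform over the support cannot be expected. L1 convergence
  tolerates this, and it suffices because only the probability of the bad points counts. The
  exponential moment is bounded through (bound times mean) instead of the squared bound: a summand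
  can be as large as a constant times h^(-d) while its mean stays bounded at good points, and this
  is what produces n h^d in the exponent. A training point is not independent of the kernel sum
  evaluated at it. Its own summand is removed, the remaining sum is treated as at a fixed point, and
  the summand is put back at a cost of at most a constant times h^(-d), negligible against n because
  n h^d tends to infinity. The two bandwidths never interact; they meet only in the common limit
  \<open>risk_limit\<close>.\<close>

lemma
  fixes f :: "'b::euclidean_space \<Rightarrow> real"
  shows integrable_lborel_translation:
      "integrable lborel f \<Longrightarrow> integrable lborel (\<lambda>x. f (x - v))"
    and integral_lborel_translation:
      "f \<in> borel_measurable borel \<Longrightarrow> (\<integral>x. f (x - v) \<partial>lborel) = (\<integral>x. f x \<partial>lborel)"
proof -
  have d: "distr lborel borel (\<lambda>x::'b. x - v) = lborel"
  proof -
    have "(\<lambda>x::'b. x - v) = (+) (- v)" by auto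
    then show ?thesis using lborel_distr_plus[of "- v"] by presburger
  qed
  show "integrable lborel (\<lambda>x. f (x - v))" if "integrable lborel f"
  proof -
    have [measurable]: "f \<in> borel_measurable borel" using that by simp
    show ?thesis
      using integrable_distr_eq[of "\<lambda>x::'b. x - v" lborel borel f] that by (simp add: d)
  qed
  show "(\<integral>x. f (x - v) \<partial>lborel) = (\<integral>x. f x \<partial>lborel)" if [measurable]: "f \<in> borel_measurable borel"
    using integral_distr[of "\<lambda>x::'b. x - v" lborel borel f] by (simp add: d)
qed

text \<open>An e/3 argument through \<open>k\<close>: by translation invariance the shifted error of
  \<open>k\<close> has the same integral as the unshifted one. It shows that continuity in the mean
  survives L1 limits, and serves both for passing from open to Borel sets and for the limit step of
  the induction below.\<close>

lemma L1_translation_continuous_approx: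
  fixes g :: "'b::euclidean_space \<Rightarrow> real"
  assumes g: "integrable lborel g"
    and approx: "\<And>e. e > 0 \<Longrightarrow> \<exists>k. integrable lborel k \<and> (\<integral>x. \<bar>g x - k x\<bar> \<partial>lborel) < e \<and>
        (\<lambda>n. \<integral>x. \<bar>k (x - v n) - k x\<bar> \<partial>lborel) \<longlonglongrightarrow> 0"
  shows "(\<lambda>n. \<integral>x. \<bar>g (x - v n) - g x\<bar> \<partial>lborel) \<longlonglongrightarrow> 0"
proof (rule LIMSEQ_I)
  fix e :: real assume "e > 0"
  then obtain k where k: "integrable lborel k" "(\<integral>x. \<bar>g x - k x\<bar> \<partial>lborel) < e / 3"
    "(\<lambda>n. \<integral>x. \<bar>k (x - v n) - k x\<bar> \<partial>lborel) \<longlonglongrightarrow> 0"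
    using approx[of "e / 3"] by auto
  note tr = integrable_lborel_translation[OF g] integrable_lborel_translation[OF k(1)]
  have gm[measurable]: "g \<in> borel_measurable borel" "k \<in> borel_measurable borel"
    using g k(1) by auto
  obtain N where N: "\<And>n. n \<ge> N \<Longrightarrow> (\<integral>x. \<bar>k (x - v n) - k x\<bar> \<partial>lborel) < e / 3"
    using LIMSEQ_D[OF k(3), of "e / 3"] \<open>e > 0\<close> by auto
  have "(\<integral>x. \<bar>g (x - v n) - g x\<bar> \<partial>lborel) < e" if "n \<ge> N" for n
  proof -
    have "(\<integral>x. \<bar>g (x - v n) - g x\<bar> \<partial>lborel) \<le>
      (\<integral>x. \<bar>g (x - v n) - k (x - v n)\<bar> + \<bar>k (x - v n) - k x\<bar> + \<bar>g x - k x\<bar> \<partial>lborel)"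
      using g k(1) tr by (intro integral_mono) auto
    also have "\<dots> = (\<integral>x. \<bar>g (x - v n) - k (x - v n)\<bar> \<partial>lborel) + (\<integral>x. \<bar>k (x - v n) - k x\<bar> \<partial>lborel)
       + (\<integral>x. \<bar>g x - k x\<bar> \<partial>lborel)"
      using g k(1) tr by simp
    also have "(\<integral>x. \<bar>g (x - v n) - k (x - v n)\<bar> \<partial>lborel) = (\<integral>x. \<bar>g x - k x\<bar> \<partial>lborel)"
      by (rule integral_lborel_translation[of "\<lambda>x. \<bar>g x - k x\<bar>"]) simp
    finally show ?thesis using N[OF that] k(2) by simp
  qed
  then show "\<exists>N. \<forall>n\<ge>N. norm ((\<integral>x. \<bar>g (x - v n) - g x\<bar> \<partial>lborel) - 0) < e"
    by auto
qed

text \<open>A point of an open set stays in the set under small shifts, so the indicator of the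
  points that leave tends to zero pointwise, dominated by the indicator of \<open>U\<close>. Points
  outside \<open>U\<close> have no such stability, which is why only departures are treated
  directly.\<close>

lemma L1_translation_continuous_open:
  fixes U :: "'b::euclidean_space set"
  assumes U: "open U" "emeasure lborel U < \<infinity>" and v: "v \<longlonglongrightarrow> 0"
  shows "(\<lambda>n. \<integral>x. \<bar>indicator U (x - v n) - indicator U x :: real\<bar> \<partial>lborel) \<longlonglongrightarrow> 0"
proof -
  have [measurable]: "U \<in> sets borel" using U by auto
  define I where "I = (indicator U :: 'b \<Rightarrow> real)"
  have Im[measurable]: "I \<in> borel_measurable borel" by (simp add: I_def)
  have I: "integrable lborel I" using U by (auto simp: I_def integrable_indicator_iff)
  have I01: "I x = 0 \<or> I x = 1" for x by (auto simp: I_def indicator_def)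
  have Ib: "\<bar>I x * (1 - I y)\<bar> \<le> I x" for x y using I01[of x] I01[of y] by auto
  have int: "integrable lborel (\<lambda>x. I x * (1 - I (x - w)))" for w
    by (rule Bochner_Integration.integrable_bound[OF I])
       (use Ib I01 in \<open>auto intro!: AE_I2 order.trans[OF Ib]\<close>)
  have *: "(\<lambda>n. \<integral>x. I x * (1 - I (x - w n)) \<partial>lborel) \<longlonglongrightarrow> 0" if w: "w \<longlonglongrightarrow> 0" for w
  proof -
    have "(\<lambda>n. \<integral>x. I x * (1 - I (x - w n)) \<partial>lborel) \<longlonglongrightarrow> integral\<^sup>L lborel (\<lambda>x::'b. 0)"
    proof (rule integral_dominated_convergence[where w=I])
      show "AE x in lborel. (\<lambda>n. I x * (1 - I (x - w n))) \<longlonglongrightarrow> 0"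
      proof (intro AE_I2)
        fix x
        show "(\<lambda>n. I x * (1 - I (x - w n))) \<longlonglongrightarrow> 0"
        proof (cases "x \<in> U")
          case True
          have "(\<lambda>n. x - w n) \<longlonglongrightarrow> x - 0" by (intro tendsto_intros w)
          then have "eventually (\<lambda>n. x - w n \<in> U) sequentially"
            using U(1) True by (auto dest: topological_tendstoD)
          then have "eventually (\<lambda>n. I x * (1 - I (x - w n)) = 0) sequentially"
            by eventually_elim (simp add: I_def)
          then show ?thesis by (rule tendsto_eventually)
        qed (simp add: I_def)
      qed
    qed (use I in \<open>auto intro!: AE_I2 order.trans[OF Ib]\<close>)
    then show ?thesis by simp
  qed
  have "(\<integral>x. \<bar>I (x - w) - I x\<bar> \<partial>lborel) =
      (\<integral>x. I x * (1 - I (x - w)) \<partial>lborel) + (\<integral>x. I x * (1 - I (x - (- w))) \<partial>lborel)" for w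
  proof -
    \<comment> \<open>The absolute difference splits into departures from \<open>U\<close> and
      arrivals in \<open>U\<close>; the arrivals under the shift by \<open>w\<close>, translated by
      \<open>w\<close>, are the departures under the shift by \<open>- w\<close>.\<close>
    have "\<bar>I (x - w) - I x\<bar> = I x * (1 - I (x - w)) + I (x - w) * (1 - I ((x - w) - (- w)))" for x
      using I01[of x] I01[of "x - w"] by auto
    then have "(\<integral>x. \<bar>I (x - w) - I x\<bar> \<partial>lborel) =
      (\<integral>x. I x * (1 - I (x - w)) + I (x - w) * (1 - I ((x - w) - (- w))) \<partial>lborel)" by presburger
    also have "\<dots> = (\<integral>x. I x * (1 - I (x - w)) \<partial>lborel) + (\<integral>x. I (x - w) * (1 - I ((x - w) - (- w))) \<partial>lborel)"
      by (intro Bochner_Integration.integral_add int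
          integrable_lborel_translation[of "\<lambda>x. I x * (1 - I (x - (- w)))"])
    also have "(\<integral>x. I (x - w) * (1 - I ((x - w) - (- w))) \<partial>lborel) = (\<integral>x. I x * (1 - I (x - (- w))) \<partial>lborel)"
      by (rule integral_lborel_translation[of "\<lambda>x. I x * (1 - I (x - (- w)))"]) simp
    finally show ?thesis .
  qed
  then show ?thesis
    using tendsto_add[OF *[OF v] *[of "\<lambda>n. - v n"]] tendsto_minus[OF v] by (simp add: I_def)
qed

text \<open>Induction over integrable functions: outer regularity reduces a Borel set of finite
  measure to an open one, and sums and dominated limits preserve the property.\<close>

lemma L1_translation_continuous:
  fixes g :: "'b::euclidean_space \<Rightarrow> real"
  assumes g: "integrable lborel g" and v: "v \<longlonglongrightarrow> 0"
  shows "(\<lambda>n. \<integral>x. \<bar>g (x - v n) - g x\<bar> \<partial>lborel) \<longlonglongrightarrow> 0"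
  using g
proof (induction rule: integrable_induct)
  case (base A c)
  show ?case
  proof (rule L1_translation_continuous_approx)
    show "integrable lborel (\<lambda>x. indicator A x *\<^sub>R c)"
      using base by (intro integrable_scaleR_left) (auto simp: integrable_indicator_iff)
    fix e :: real assume "e > 0"
    \<comment> \<open>The measure of \<open>U - A\<close> gets multiplied by the modulus of
      \<open>c\<close>; the added 1 keeps the quotient defined for \<open>c = 0\<close> and makes
      the final inequality strict.\<close>
    define e' where "e' = e / (1 + \<bar>c\<bar>)"
    have e': "e' > 0" using \<open>e > 0\<close> by (simp add: e'_def add_pos_nonneg)
    obtain U where U: "open U" "A \<subseteq> U" "emeasure lborel (U - A) < ennreal e'"
      using outer_regular_lborel[of A e'] base e' by auto
    have [measurable]: "A \<in> sets borel" "U \<in> sets borel" using base U by auto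
    have fU: "emeasure lborel U < \<infinity>"
    proof -
      have "emeasure lborel U \<le> emeasure lborel A + emeasure lborel (U - A)"
        by (rule order.trans[OF _ emeasure_subadditive]) (auto intro!: emeasure_mono)
      also have "\<dots> < \<infinity>" using base order.strict_trans[OF U(3) ennreal_less_top] by (simp add: ennreal_add_eq_top less_top)
      finally show ?thesis .
    qed
    have iU: "integrable lborel (indicator U :: 'b \<Rightarrow> real)" using fU by (auto simp: integrable_indicator_iff)
    have m: "measure lborel (U - A) < e'"
      using U(3) e' order.strict_trans[OF U(3) ennreal_less_top]
      by (subst (asm) emeasure_eq_ennreal_measure) (auto simp: ennreal_less_iff)
    have "(\<integral>x. \<bar>indicator A x *\<^sub>R c - indicator U x *\<^sub>R c\<bar> \<partial>lborel) = (\<integral>x. \<bar>c\<bar> * indicator (U - A) x \<partial>lborel)"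
      using U(2) by (intro Bochner_Integration.integral_cong refl) (auto simp: indicator_def)
    also have "\<dots> = \<bar>c\<bar> * measure lborel (U - A)" by simp
    also have "\<dots> \<le> \<bar>c\<bar> * e'" using m by (intro mult_left_mono) auto
    also have "\<dots> < e" using \<open>e > 0\<close> by (simp add: e'_def field_simps)
    finally have 1: "(\<integral>x. \<bar>indicator A x *\<^sub>R c - indicator U x *\<^sub>R c\<bar> \<partial>lborel) < e" .
    have "(\<lambda>n. \<bar>c\<bar> * (\<integral>x. \<bar>indicator U (x - v n) - indicator U x :: real\<bar> \<partial>lborel)) \<longlonglongrightarrow> \<bar>c\<bar> * 0"
      by (intro tendsto_intros L1_translation_continuous_open U fU v)
    moreover have "\<bar>c\<bar> * (\<integral>x. \<bar>indicator U (x - w) - indicator U x :: real\<bar> \<partial>lborel) =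
       (\<integral>x. \<bar>indicator U (x - w) *\<^sub>R c - indicator U x *\<^sub>R c\<bar> \<partial>lborel)" for w
      by (subst integral_mult_right_zero[symmetric], intro Bochner_Integration.integral_cong refl)
         (auto simp: indicator_def)
    ultimately show "\<exists>k. integrable lborel k \<and> (\<integral>x. \<bar>indicator A x *\<^sub>R c - k x\<bar> \<partial>lborel) < e \<and>
        (\<lambda>n. \<integral>x. \<bar>k (x - v n) - k x\<bar> \<partial>lborel) \<longlonglongrightarrow> 0"
      using 1 iU by (intro exI[of _ "\<lambda>x. indicator U x *\<^sub>R c"]) auto
  qed
next
  case (add f g)
  note tr = integrable_lborel_translation[OF add(1)] integrable_lborel_translation[OF add(2)]
  have "(\<lambda>n. (\<integral>x. \<bar>f (x - v n) - f x\<bar> \<partial>lborel) + (\<integral>x. \<bar>g (x - v n) - g x\<bar> \<partial>lborel)) \<longlonglongrightarrow> 0 + 0"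
    by (intro tendsto_add add)
  then have lim: "(\<lambda>n. (\<integral>x. \<bar>f (x - v n) - f x\<bar> \<partial>lborel) + (\<integral>x. \<bar>g (x - v n) - g x\<bar> \<partial>lborel)) \<longlonglongrightarrow> 0"
    by simp
  have "(\<integral>x. \<bar>f (x - v n) + g (x - v n) - (f x + g x)\<bar> \<partial>lborel) \<le>
      (\<integral>x. \<bar>f (x - v n) - f x\<bar> \<partial>lborel) + (\<integral>x. \<bar>g (x - v n) - g x\<bar> \<partial>lborel)" for n
  proof -
    have "(\<integral>x. \<bar>f (x - v n) + g (x - v n) - (f x + g x)\<bar> \<partial>lborel) \<le>
        (\<integral>x. \<bar>f (x - v n) - f x\<bar> + \<bar>g (x - v n) - g x\<bar> \<partial>lborel)"
      using add(1,2) tr by (intro integral_mono) auto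
    also have "\<dots> = (\<integral>x. \<bar>f (x - v n) - f x\<bar> \<partial>lborel) + (\<integral>x. \<bar>g (x - v n) - g x\<bar> \<partial>lborel)"
      using add(1,2) tr by simp
    finally show ?thesis .
  qed
  then show ?case
    by (intro tendsto_sandwich[OF _ _ tendsto_const lim]) (auto intro!: always_eventually)
next
  case (lim f s)
  show ?case
  proof (rule L1_translation_continuous_approx[OF lim.hyps(4)])
    fix e :: real assume "e > 0"
    have [measurable]: "f \<in> borel_measurable borel" "\<And>i. s i \<in> borel_measurable borel"
      using lim by auto
    have sf: "(\<lambda>i. \<bar>f x - s i x\<bar>) \<longlonglongrightarrow> 0" for x
      using tendsto_rabs[OF tendsto_diff[OF tendsto_const lim.hyps(2)], of x "f x"] by simp
    \<comment> \<open>The induction rule supplies approximants dominated by twice the modulus of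
      \<open>f\<close>, hence the factor 3.\<close>
    have bd: "\<bar>f x - s i x\<bar> \<le> 3 * \<bar>f x\<bar>" for i x
      using lim.hyps(3)[of x i] by simp
    have "(\<lambda>i. \<integral>x. \<bar>f x - s i x\<bar> \<partial>lborel) \<longlonglongrightarrow> integral\<^sup>L lborel (\<lambda>x::'b. 0)"
      by (rule integral_dominated_convergence[where w="\<lambda>x. 3 * \<bar>f x\<bar>"])
         (use lim.hyps(4) sf bd in auto)
    then have "eventually (\<lambda>i. (\<integral>x. \<bar>f x - s i x\<bar> \<partial>lborel) < e) sequentially"
      using \<open>e > 0\<close> by (intro order_tendstoD(2)) auto
    then obtain i where "(\<integral>x. \<bar>f x - s i x\<bar> \<partial>lborel) < e" by (auto simp: eventually_sequentially)
    then show "\<exists>k. integrable lborel k \<and> (\<integral>x. \<bar>f x - k x\<bar> \<partial>lborel) < e \<and>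
        (\<lambda>n. \<integral>x. \<bar>k (x - v n) - k x\<bar> \<partial>lborel) \<longlonglongrightarrow> 0"
      using lim.hyps(1) lim.IH by blast
  qed
qed

section \<open>Gaussian smoothing\<close>

definition smooth :: "real \<Rightarrow> (real ^ 'd \<Rightarrow> real) \<Rightarrow> real ^ 'd \<Rightarrow> real" where
  "smooth h g x = (\<integral>y. scaled_kernel h (x - y) * g y \<partial>lborel)"

text \<open>This is the value of \<open>gauss_kernel\<close> at the origin, hence its maximum. The
  type argument only carries the dimension.\<close>

definition kernel_max :: "'d itself \<Rightarrow> real" where
  "kernel_max _ = (2 * pi) powr (- real CARD('d) / 2)"

lemma kernel_max_pos: "0 < kernel_max TYPE('d)"
  by (simp add: kernel_max_def)

lemma gauss_kernel_pos: "0 < gauss_kernel u"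
  by (simp add: gauss_kernel_def)

lemma gauss_kernel_le: "gauss_kernel (u :: real ^ 'd) \<le> kernel_max TYPE('d)"
  by (simp add: gauss_kernel_def kernel_max_def mult_le_cancel_left1)

lemma gauss_kernel_measurable[measurable]: "gauss_kernel \<in> borel_measurable borel"
  unfolding gauss_kernel_def[abs_def] by measurable

lemma scaled_kernel_measurable[measurable]: "scaled_kernel h \<in> borel_measurable borel"
  unfolding scaled_kernel_def[abs_def] by measurable

lemma scaled_kernel_pos: "0 < h \<Longrightarrow> 0 < scaled_kernel h u"
  by (simp add: scaled_kernel_def gauss_kernel_pos)

lemma scaled_kernel_le:
  "0 < h \<Longrightarrow> scaled_kernel h (u :: real ^ 'd) \<le> kernel_max TYPE('d) / h ^ CARD('d)"
  by (simp add: scaled_kernel_def gauss_kernel_le divide_right_mono)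

lemma scaled_kernel_minus: "scaled_kernel h (- u) = scaled_kernel h u"
  by (simp add: scaled_kernel_def gauss_kernel_def)

text \<open>The kernel factors over the coordinates into standard normal densities, each of total
  mass 1.\<close>

lemma nn_integral_gauss_kernel: "(\<integral>\<^sup>+u. gauss_kernel (u :: real ^ 'd) \<partial>lborel) = 1"
proof -
  have prod: "gauss_kernel u = (\<Prod>b\<in>Basis. std_normal_density (u \<bullet> b))" for u :: "real ^ 'd"
  proof -
    have "(\<Prod>b\<in>Basis. std_normal_density (u \<bullet> b)) =
        (1 / sqrt (2 * pi)) ^ CARD('d) * exp (\<Sum>b\<in>Basis. - (u \<bullet> b)\<^sup>2 / 2)"
      unfolding std_normal_density_def prod.distrib exp_sum[OF finite_Basis] prod_constant by simp
    also have "(\<Sum>b\<in>Basis. - (u \<bullet> b)\<^sup>2 / 2) = - (norm u)\<^sup>2 / 2"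
      unfolding power2_norm_eq_inner euclidean_inner[of u u]
      by (simp add: sum_negf sum_divide_distrib power2_eq_square)
    also have "(1 / sqrt (2 * pi)) ^ CARD('d) = (2 * pi) powr (- real CARD('d) / 2)"
    proof -
      have "1 / sqrt (2 * pi) = (2 * pi) powr (- (1 / 2))"
        by (simp add: powr_minus_divide powr_half_sqrt)
      then have "(1 / sqrt (2 * pi)) ^ CARD('d) = ((2 * pi) powr (- (1 / 2))) powr real CARD('d)"
        by (simp add: powr_realpow)
      then show ?thesis by (simp add: powr_powr)
    qed
    finally show ?thesis by (simp add: gauss_kernel_def)
  qed
  have "(\<integral>\<^sup>+u. gauss_kernel (u :: real ^ 'd) \<partial>lborel) =
      (\<integral>\<^sup>+u. (\<Prod>b\<in>Basis. ennreal (std_normal_density ((u :: real ^ 'd) \<bullet> b))) \<partial>lborel)"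
    by (simp add: prod prod_ennreal)
  also have "\<dots> = (\<Prod>b\<in>(Basis :: (real ^ 'd) set). \<integral>\<^sup>+x. ennreal (std_normal_density x) \<partial>lborel)"
    by (intro nn_integral_lborel_prod) auto
  also have "(\<integral>\<^sup>+x. ennreal (std_normal_density x) \<partial>lborel) = 1"
    by (subst nn_integral_eq_integral) (auto simp: integral_normal_density)
  finally show ?thesis by simp
qed

lemma integrable_gauss_kernel: "integrable lborel gauss_kernel"
  by (intro integrableI_nonneg) (auto simp: nn_integral_gauss_kernel gauss_kernel_pos less_imp_le)

lemma integral_gauss_kernel: "(\<integral>u. gauss_kernel u \<partial>lborel) = 1"
  by (subst integral_eq_nn_integral) (auto simp: nn_integral_gauss_kernel gauss_kernel_pos less_imp_le)

lemma smooth_measurable[measurable]: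
  assumes [measurable]: "g \<in> borel_measurable borel"
  shows "smooth h g \<in> borel_measurable borel"
  unfolding smooth_def[abs_def] by measurable

text \<open>The substitution y = x - h u moves the bandwidth from the kernel into a translation of
  \<open>g\<close>, where continuity in the mean can act.\<close>

lemma smooth_eq_translates:
  fixes g :: "real ^ 'd \<Rightarrow> real"
  assumes h: "0 < h" and g: "integrable lborel g"
  shows "integrable lborel (\<lambda>u. gauss_kernel u * g (x - h *\<^sub>R u))"
    and "smooth h g x = (\<integral>u. gauss_kernel u * g (x - h *\<^sub>R u) \<partial>lborel)"
proof -
  have [measurable]: "g \<in> borel_measurable borel" using g by simp
  \<comment> \<open>The change of variables as an identity of measures, with
    \<open>h ^ CARD('d)\<close> as Jacobian factor.\<close>
  have d: "lborel = density (distr lborel borel (\<lambda>u. x - h *\<^sub>R u)) (\<lambda>_. ennreal (h ^ CARD('d)))"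
    using lborel_affine[of "- h" x] h by simp
  have i: "integrable lborel (\<lambda>y. scaled_kernel h (x - y) * g y)"
    by (rule Bochner_Integration.integrable_bound
          [OF integrable_mult_right[OF g, of "kernel_max TYPE('d) / h ^ CARD('d)"]])
       (use h mult_right_mono[OF scaled_kernel_le[OF h] abs_ge_zero] in
         \<open>auto simp: abs_mult abs_of_pos[OF scaled_kernel_pos[OF h]] abs_of_pos[OF kernel_max_pos]\<close>)
  have e: "scaled_kernel h (h *\<^sub>R u) = gauss_kernel u / h ^ CARD('d)" for u :: "real ^ 'd"
    using h by (simp add: scaled_kernel_def)
  have "integrable (density (distr lborel borel (\<lambda>u. x - h *\<^sub>R u)) (\<lambda>_. ennreal (h ^ CARD('d))))
     (\<lambda>y. scaled_kernel h (x - y) * g y)" using i by (simp only: d[symmetric])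
  then have "integrable lborel (\<lambda>u. gauss_kernel u / h ^ CARD('d) * g (x - h *\<^sub>R u))"
    by (subst (asm) integrable_density) (use h in \<open>auto simp: integrable_distr_eq e\<close>)
  note i2 = integrable_mult_right[OF this, of "h ^ CARD('d)"]
  have "(\<lambda>u. h ^ CARD('d) * (gauss_kernel u / h ^ CARD('d) * g (x - h *\<^sub>R u))) =
      (\<lambda>u. gauss_kernel u * g (x - h *\<^sub>R u))"
    using h by auto
  with i2 show "integrable lborel (\<lambda>u. gauss_kernel u * g (x - h *\<^sub>R u))" by (simp only:)
  have "smooth h g x = (\<integral>y. scaled_kernel h (x - y) * g y
      \<partial>density (distr lborel borel (\<lambda>u. x - h *\<^sub>R u)) (\<lambda>_. ennreal (h ^ CARD('d))))"
    unfolding smooth_def by (subst d) (rule refl)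
  also have "\<dots> = (\<integral>u. h ^ CARD('d) * (gauss_kernel u / h ^ CARD('d) * g (x - h *\<^sub>R u)) \<partial>lborel)"
    by (subst integral_density) (use h in \<open>auto simp: integral_distr e\<close>)
  finally show "smooth h g x = (\<integral>u. gauss_kernel u * g (x - h *\<^sub>R u) \<partial>lborel)" using h by simp
qed

text \<open>As the kernel has mass 1, the smoothing error is a Gaussian average of translation
  differences. Tonelli bounds its L1 norm by the Gaussian average of
  \<open>T (h n *\<^sub>R u)\<close>, where \<open>T\<close> is the L1 modulus of translation. It
  tends to 0 for each \<open>u\<close> and is at most twice the L1 norm of \<open>g\<close>, so
  dominated convergence applies. Using the nonnegative integral spares a separate integrability
  proof for the smoothed function.\<close>

lemma smooth_tendsto_L1:
  fixes g :: "real ^ 'd \<Rightarrow> real"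
  assumes g: "integrable lborel g" and h: "eventually (\<lambda>n. 0 < h n) sequentially" "h \<longlonglongrightarrow> 0"
  shows "(\<lambda>n. \<integral>\<^sup>+x. ennreal \<bar>smooth (h n) g x - g x\<bar> \<partial>lborel) \<longlonglongrightarrow> 0"
proof -
  have gm[measurable]: "g \<in> borel_measurable borel" using g by simp
  define T where "T v = (\<integral>x. \<bar>g (x - v) - g x\<bar> \<partial>lborel)" for v
  have T_meas[measurable]: "T \<in> borel_measurable borel" unfolding T_def[abs_def] by measurable
  have gt: "integrable lborel (\<lambda>x. \<bar>g (x - v) - g x\<bar>)" for v
    using integrable_lborel_translation[OF g] g by auto
  have T0: "0 \<le> T v" for v by (simp add: T_def)
  have Tle: "T v \<le> 2 * (\<integral>x. \<bar>g x\<bar> \<partial>lborel)" for v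
  proof -
    have "T v \<le> (\<integral>x. \<bar>g (x - v)\<bar> + \<bar>g x\<bar> \<partial>lborel)"
      unfolding T_def by (intro integral_mono gt) (use integrable_lborel_translation[OF g] g in auto)
    also have "\<dots> = (\<integral>x. \<bar>g (x - v)\<bar> \<partial>lborel) + (\<integral>x. \<bar>g x\<bar> \<partial>lborel)"
      using integrable_lborel_translation[OF g] g by simp
    also have "(\<integral>x. \<bar>g (x - v)\<bar> \<partial>lborel) = (\<integral>x. \<bar>g x\<bar> \<partial>lborel)"
      by (rule integral_lborel_translation[of "\<lambda>x. \<bar>g x\<bar>"]) simp
    finally show ?thesis by simp
  qed
  have iK: "integrable lborel (\<lambda>u :: real ^ 'd. gauss_kernel u * T (k *\<^sub>R u))" for k
    by (rule Bochner_Integration.integrable_bound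
          [OF integrable_mult_left[OF integrable_gauss_kernel, of "2 * (\<integral>x. \<bar>g x\<bar> \<partial>lborel)"]])
       (auto simp: abs_mult gauss_kernel_pos T0 intro!: AE_I2 mult_mono order.trans[OF Tle] less_imp_le[OF gauss_kernel_pos])
  have bound: "(\<integral>\<^sup>+x. ennreal \<bar>smooth k g x - g x\<bar> \<partial>lborel) \<le>
      ennreal (\<integral>u. gauss_kernel u * T (k *\<^sub>R u) \<partial>lborel)" if k: "0 < k" for k
  proof -
    have pt: "ennreal \<bar>smooth k g x - g x\<bar> \<le>
        (\<integral>\<^sup>+u. ennreal (gauss_kernel u * \<bar>g (x - k *\<^sub>R u) - g x\<bar>) \<partial>lborel)" for x
    proof -
      note i1 = smooth_eq_translates(1)[OF k g, of x]
      have i2: "integrable lborel (\<lambda>u. gauss_kernel u * g x)" by (intro integrable_mult_left integrable_gauss_kernel)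
      have "smooth k g x - g x = (\<integral>u. gauss_kernel u * g (x - k *\<^sub>R u) - gauss_kernel u * g x \<partial>lborel)"
        by (subst Bochner_Integration.integral_diff[OF i1 i2])
           (simp add: smooth_eq_translates(2)[OF k g] integral_gauss_kernel)
      also have "ennreal \<bar>\<dots>\<bar> \<le> (\<integral>\<^sup>+u. ennreal \<bar>gauss_kernel u * g (x - k *\<^sub>R u) - gauss_kernel u * g x\<bar> \<partial>lborel)"
        using integral_norm_bound_ennreal[OF Bochner_Integration.integrable_diff[OF i1 i2]]
        by (simp only: real_norm_def)
      also have "\<dots> = (\<integral>\<^sup>+u. ennreal (gauss_kernel u * \<bar>g (x - k *\<^sub>R u) - g x\<bar>) \<partial>lborel)"
        by (simp add: right_diff_distrib[symmetric] abs_mult abs_of_pos[OF gauss_kernel_pos])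
      finally show ?thesis .
    qed
    have "(\<integral>\<^sup>+x. ennreal \<bar>smooth k g x - g x\<bar> \<partial>lborel) \<le>
       (\<integral>\<^sup>+x. \<integral>\<^sup>+u. ennreal (gauss_kernel u * \<bar>g (x - k *\<^sub>R u) - g x\<bar>) \<partial>lborel \<partial>lborel)"
      by (intro nn_integral_mono pt)
    also have "\<dots> = (\<integral>\<^sup>+u. \<integral>\<^sup>+x. ennreal (gauss_kernel u * \<bar>g (x - k *\<^sub>R u) - g x\<bar>) \<partial>lborel \<partial>lborel)"
      by (rule lborel_pair.Fubini') measurable
    also have "\<dots> = (\<integral>\<^sup>+u. ennreal (gauss_kernel u * T (k *\<^sub>R u)) \<partial>lborel)"
    proof (intro nn_integral_cong)
      fix u :: "real ^ 'd"
      have "(\<integral>\<^sup>+x. ennreal (gauss_kernel u * \<bar>g (x - k *\<^sub>R u) - g x\<bar>) \<partial>lborel) =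
        ennreal (\<integral>x. gauss_kernel u * \<bar>g (x - k *\<^sub>R u) - g x\<bar> \<partial>lborel)"
        by (intro nn_integral_eq_integral integrable_mult_right gt)
           (auto intro!: AE_I2 mult_nonneg_nonneg less_imp_le[OF gauss_kernel_pos])
      then show "(\<integral>\<^sup>+x. ennreal (gauss_kernel u * \<bar>g (x - k *\<^sub>R u) - g x\<bar>) \<partial>lborel) =
        ennreal (gauss_kernel u * T (k *\<^sub>R u))" by (simp add: T_def)
    qed
    also have "\<dots> = ennreal (\<integral>u. gauss_kernel u * T (k *\<^sub>R u) \<partial>lborel)"
      by (intro nn_integral_eq_integral iK)
         (auto intro!: AE_I2 mult_nonneg_nonneg T0 less_imp_le[OF gauss_kernel_pos])
    finally show ?thesis .
  qed
  have "(\<lambda>n. \<integral>u. gauss_kernel (u :: real ^ 'd) * T (h n *\<^sub>R u) \<partial>lborel) \<longlonglongrightarrow>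
      integral\<^sup>L lborel (\<lambda>u :: real ^ 'd. 0)"
  proof (rule integral_dominated_convergence
      [where w="\<lambda>u. gauss_kernel u * (2 * (\<integral>x. \<bar>g x\<bar> \<partial>lborel))"])
    show "integrable lborel (\<lambda>u :: real ^ 'd. gauss_kernel u * (2 * (\<integral>x. \<bar>g x\<bar> \<partial>lborel)))"
      by (intro integrable_mult_left integrable_gauss_kernel)
    show "AE u in lborel. norm (gauss_kernel (u :: real ^ 'd) * T (h n *\<^sub>R u)) \<le> gauss_kernel u * (2 * (\<integral>x. \<bar>g x\<bar> \<partial>lborel))" for n
      using T0 Tle by (auto simp: abs_mult gauss_kernel_pos less_imp_le intro!: mult_left_mono)
    show "AE u in lborel. (\<lambda>n. gauss_kernel (u :: real ^ 'd) * T (h n *\<^sub>R u)) \<longlonglongrightarrow> 0"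
    proof (intro AE_I2)
      fix u :: "real ^ 'd"
      have "(\<lambda>n. h n *\<^sub>R u) \<longlonglongrightarrow> 0 *\<^sub>R u" by (intro tendsto_intros h)
      then have "(\<lambda>n. T (h n *\<^sub>R u)) \<longlonglongrightarrow> 0"
        unfolding T_def using L1_translation_continuous[OF g] by simp
      then show "(\<lambda>n. gauss_kernel u * T (h n *\<^sub>R u)) \<longlonglongrightarrow> 0" by (rule tendsto_mult_right_zero)
    qed
  qed measurable
  then have lim: "(\<lambda>n. ennreal (\<integral>u. gauss_kernel (u :: real ^ 'd) * T (h n *\<^sub>R u) \<partial>lborel)) \<longlonglongrightarrow> ennreal 0"
    by (intro tendsto_ennrealI) simp
  show ?thesis
    by (rule tendsto_sandwich[OF _ _ tendsto_const lim[simplified]])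
       (use h(1) in \<open>auto elim!: eventually_mono intro!: bound\<close>)
qed

section \<open>Concentration and almost sure convergence\<close>

text \<open>For negative z = -y the claim says that (1 - y + y^2) exp y is at least 1. Replacing exp
  y by its quadratic Taylor polynomial already gives a product 1 + y^2/2 + y^3/2 + y^4/2.\<close>

lemma exp_le_quadratic:
  fixes z :: real
  assumes "\<bar>z\<bar> \<le> 1"
  shows "exp z \<le> 1 + z + z\<^sup>2"
proof (cases "0 \<le> z")
  case True
  then show ?thesis using exp_bound[of z] assms by simp
next
  case False
  define y where "y = - z"
  have y: "0 \<le> y" using False by (simp add: y_def)
  have "1 \<le> 1 + y\<^sup>2 / 2 + y ^ 3 / 2 + y ^ 4 / 2" using y by simp
  also have "\<dots> = (1 - y + y\<^sup>2) * (1 + y + y\<^sup>2 / 2)"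
    by (simp add: field_simps power2_eq_square power3_eq_cube power4_eq_xxxx)
  also have "\<dots> \<le> (1 - y + y\<^sup>2) * exp y"
  proof (rule mult_left_mono[OF exp_lower_Taylor_quadratic[OF y]])
    have "(1 - y)\<^sup>2 + y \<ge> 0" using y by simp
    then show "0 \<le> 1 - y + y\<^sup>2" using y by (simp add: power2_eq_square algebra_simps)
  qed
  finally have "exp (- y) \<le> 1 - y + y\<^sup>2" by (simp add: exp_minus field_simps)
  then show ?thesis by (simp add: y_def)
qed

text \<open>From 0 \<le> W \<le> b follows W^2 \<le> b W, so the second moment is at most b times
  the mean. For kernel values b is of order h^(-d) and the mean is bounded; the cruder bound b^2
  would leave only n h^(2d) in the exponents below.\<close>

lemma (in prob_space) exp_moment_le:
  fixes W :: "'a \<Rightarrow> real"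
  assumes W[measurable]: "W \<in> borel_measurable M" and b: "\<And>\<omega>. 0 \<le> W \<omega> \<and> W \<omega> \<le> b"
    and t: "\<bar>t\<bar> * b \<le> 1"
  shows "integrable M (\<lambda>\<omega>. exp (t * (W \<omega> - expectation W)))"
    and "expectation (\<lambda>\<omega>. exp (t * (W \<omega> - expectation W))) \<le> exp (t\<^sup>2 * b * expectation W)"
proof -
  define \<mu> where "\<mu> = expectation W"
  have tW: "\<bar>t * W \<omega>\<bar> \<le> 1" for \<omega>
    using b[of \<omega>] t mult_left_mono[of "W \<omega>" b "\<bar>t\<bar>"] by (auto simp: abs_mult)
  have iW: "integrable M W" by (rule integrable_const_bound[of _ b]) (use b in auto)
  have iE: "integrable M (\<lambda>\<omega>. exp (t * W \<omega>))"
    by (rule integrable_const_bound[of _ "exp 1"]) (use tW in \<open>auto simp: abs_le_iff\<close>)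
  have eq: "(\<lambda>\<omega>. exp (t * (W \<omega> - \<mu>))) = (\<lambda>\<omega>. exp (- t * \<mu>) * exp (t * W \<omega>))"
    by (simp add: exp_add[symmetric] algebra_simps)
  show "integrable M (\<lambda>\<omega>. exp (t * (W \<omega> - expectation W)))"
    unfolding \<mu>_def[symmetric] eq using iE by simp
  have "expectation (\<lambda>\<omega>. exp (t * W \<omega>)) \<le> expectation (\<lambda>\<omega>. 1 + (t + t\<^sup>2 * b) * W \<omega>)"
  proof (intro integral_mono iE)
    show "integrable M (\<lambda>\<omega>. 1 + (t + t\<^sup>2 * b) * W \<omega>)" using iW by simp
    fix \<omega>
    have "(t * W \<omega>)\<^sup>2 \<le> t\<^sup>2 * b * W \<omega>"
      using mult_left_mono[of "W \<omega> * W \<omega>" "b * W \<omega>" "t\<^sup>2"] b[of \<omega>]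
      by (simp add: power2_eq_square mult_right_mono algebra_simps)
    then show "exp (t * W \<omega>) \<le> 1 + (t + t\<^sup>2 * b) * W \<omega>"
      using exp_le_quadratic[OF tW[of \<omega>]] by (simp add: algebra_simps)
  qed
  also have "\<dots> = 1 + (t + t\<^sup>2 * b) * \<mu>"
    using iW by (simp add: \<mu>_def prob_space)
  also have "\<dots> \<le> exp ((t + t\<^sup>2 * b) * \<mu>)" by (rule exp_ge_add_one_self)
  finally have "exp (- t * \<mu>) * expectation (\<lambda>\<omega>. exp (t * W \<omega>)) \<le> exp (- t * \<mu>) * exp ((t + t\<^sup>2 * b) * \<mu>)"
    by (intro mult_left_mono) auto
  then show "expectation (\<lambda>\<omega>. exp (t * (W \<omega> - expectation W))) \<le> exp (t\<^sup>2 * b * expectation W)"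
    unfolding \<mu>_def[symmetric] eq integral_mult_right_zero by (simp add: exp_add[symmetric] algebra_simps)
qed

text \<open>Markov's inequality for the exponential of the centred sum, whose expectation factors by
  independence. The sign of \<open>t\<close> is free, so that both tails are covered.\<close>

lemma (in prob_space) chernoff_sum:
  fixes W :: "'i \<Rightarrow> 'a \<Rightarrow> real" and b \<mu> t a :: real
  assumes I: "finite I" and ind: "indep_vars (\<lambda>_. borel) W I"
    and b: "\<And>i \<omega>. i \<in> I \<Longrightarrow> 0 \<le> W i \<omega> \<and> W i \<omega> \<le> b"
    and \<mu>: "\<And>i. i \<in> I \<Longrightarrow> expectation (W i) = \<mu>"
    and t: "\<bar>t\<bar> * b \<le> 1"
  shows "prob {\<omega> \<in> space M. a \<le> t * ((\<Sum>i\<in>I. W i \<omega>) - card I * \<mu>)} \<le> exp (card I * (t\<^sup>2 * b * \<mu>) - a)"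
proof -
  define V where "V i \<omega> = exp (t * (W i \<omega> - \<mu>))" for i \<omega>
  have W: "W i \<in> borel_measurable M" if "i \<in> I" for i using ind that by (auto simp: indep_vars_def)
  have indV: "indep_vars (\<lambda>_. borel) V I"
    unfolding V_def[abs_def] by (rule indep_vars_compose2[OF ind, of "\<lambda>i w. exp (t * (w - \<mu>))"]) auto
  have iV: "integrable M (V i)" and EV: "expectation (V i) \<le> exp (t\<^sup>2 * b * \<mu>)" if "i \<in> I" for i
    using exp_moment_le[OF W b t, OF that that] \<mu>[OF that] by (auto simp: V_def[abs_def])
  have prod: "exp (t * ((\<Sum>i\<in>I. W i \<omega>) - card I * \<mu>)) = (\<Prod>i\<in>I. V i \<omega>)" for \<omega>
    using I by (simp add: V_def exp_sum[symmetric] sum_distrib_left sum_subtractf right_diff_distrib)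
  have "prob {\<omega> \<in> space M. a \<le> t * ((\<Sum>i\<in>I. W i \<omega>) - card I * \<mu>)} =
      prob {\<omega> \<in> space M. exp a \<le> (\<Prod>i\<in>I. V i \<omega>)}"
    by (simp add: prod[symmetric])
  also have "\<dots> \<le> expectation (\<lambda>\<omega>. \<Prod>i\<in>I. V i \<omega>) / exp a"
    by (rule integral_Markov_inequality_measure[where A="{}"])
       (use indep_vars_integrable[OF I indV iV] in \<open>auto simp: V_def intro!: prod_nonneg\<close>)
  also have "expectation (\<lambda>\<omega>. \<Prod>i\<in>I. V i \<omega>) = (\<Prod>i\<in>I. expectation (V i))"
    by (rule indep_vars_lebesgue_integral[OF I indV iV])
  also have "(\<Prod>i\<in>I. expectation (V i)) / exp a \<le> (\<Prod>i\<in>I. exp (t\<^sup>2 * b * \<mu>)) / exp a"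
    by (intro divide_right_mono prod_mono) (auto simp: EV V_def)
  also have "\<dots> = exp (card I * (t\<^sup>2 * b * \<mu>) - a)"
    by (simp add: exp_diff exp_of_nat_mult)
  finally show ?thesis .
qed

text \<open>Deviations are measured on the scale \<open>n\<close>, which only has to dominate
  \<open>card I\<close>. The same bound thus serves the full sample and the sample with one point
  removed.\<close>

lemma (in prob_space) bernstein_sum:
  fixes W :: "'i \<Rightarrow> 'a \<Rightarrow> real" and n b \<mu> B \<delta> :: real
  assumes I: "finite I" "real (card I) \<le> n" and ind: "indep_vars (\<lambda>_. borel) W I"
    and b: "\<And>i \<omega>. i \<in> I \<Longrightarrow> 0 \<le> W i \<omega> \<and> W i \<omega> \<le> b" "0 < b"
    and \<mu>: "\<And>i. i \<in> I \<Longrightarrow> expectation (W i) = \<mu>" "\<mu> \<le> B"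
    and \<delta>: "0 < \<delta>" "\<delta> \<le> B"
  shows "prob {\<omega> \<in> space M. n * \<delta> \<le> \<bar>(\<Sum>i\<in>I. W i \<omega>) - card I * \<mu>\<bar>} \<le> 2 * exp (- (n * \<delta>\<^sup>2 / (4 * B * b)))"
proof -
  \<comment> \<open>This minimises the exponent n (s^2 b B - s \<delta>), with minimum - n
    \<delta>^2 / (4 B b); \<open>\<delta> \<le> B\<close> ensures
    \<open>s * b \<le> 1\<close>.\<close>
  define s where "s = \<delta> / (2 * B * b)"
  have B: "B > 0" using \<delta> by simp
  have s: "s > 0" "s * b \<le> 1" using \<delta> b(2) B by (auto simp: s_def field_simps)
  define a where "a = s * (n * \<delta>)"
  have W: "W i \<in> borel_measurable M" if "i \<in> I" for i using ind that by (auto simp: indep_vars_def)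
  note [measurable] = W
  have ex: "real (card I) * (s\<^sup>2 * b * \<mu>) - a \<le> - (n * \<delta>\<^sup>2 / (4 * B * b))"
  proof -
    have "real (card I) * (s\<^sup>2 * b * \<mu>) \<le> real (card I) * (s\<^sup>2 * b * B)"
      using \<mu>(2) b(2) by (intro mult_left_mono) auto
    also have "\<dots> \<le> n * (s\<^sup>2 * b * B)" using I(2) b(2) B by (intro mult_right_mono) auto
    also have "\<dots> = n * \<delta>\<^sup>2 / (4 * B * b)" using B b(2) by (simp add: s_def field_simps power2_eq_square)
    finally have "real (card I) * (s\<^sup>2 * b * \<mu>) \<le> n * \<delta>\<^sup>2 / (4 * B * b)" .
    moreover have "a = n * \<delta>\<^sup>2 / (4 * B * b) + n * \<delta>\<^sup>2 / (4 * B * b)"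
      using B b(2) by (simp add: a_def s_def field_simps power2_eq_square)
    ultimately show ?thesis by simp
  qed
  let ?S = "\<lambda>\<omega>. (\<Sum>i\<in>I. W i \<omega>) - card I * \<mu>"
  let ?A = "\<lambda>t. {\<omega> \<in> space M. a \<le> t * ?S \<omega>}"
  have one: "prob (?A t) \<le> exp (- (n * \<delta>\<^sup>2 / (4 * B * b)))" if "t = s \<or> t = - s" for t
  proof -
    have "prob (?A t) \<le> exp (card I * (t\<^sup>2 * b * \<mu>) - a)"
      by (rule chernoff_sum[OF I(1) ind b(1) \<mu>(1)]) (use that s in auto)
    also have "\<dots> \<le> exp (- (n * \<delta>\<^sup>2 / (4 * B * b)))" using ex that by auto
    finally show ?thesis .
  qed
  have [measurable]: "(\<lambda>\<omega>. ?S \<omega>) \<in> borel_measurable M" by measurable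
  have "{\<omega> \<in> space M. n * \<delta> \<le> \<bar>?S \<omega>\<bar>} \<subseteq> ?A s \<union> ?A (- s)"
  proof safe
    fix \<omega> assume "n * \<delta> \<le> \<bar>?S \<omega>\<bar>" and n: "\<not> a \<le> - s * ?S \<omega>"
    then have "a \<le> s * \<bar>?S \<omega>\<bar>" unfolding a_def using s by (intro mult_left_mono) auto
    then show "a \<le> s * ?S \<omega>" using n by (cases "0 \<le> ?S \<omega>") (auto simp: abs_if right_diff_distrib)
  qed
  then have "prob {\<omega> \<in> space M. n * \<delta> \<le> \<bar>?S \<omega>\<bar>} \<le> prob (?A s \<union> ?A (- s))"
    by (intro finite_measure_mono) auto
  also have "\<dots> \<le> prob (?A s) + prob (?A (- s))"
    by (intro measure_Un_le) auto
  finally show ?thesis using one[of s] one[of "- s"] by simp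
qed

text \<open>The exceptional null set may depend on \<open>e\<close>; the countably many tolerances
  1/(k+1) suffice, so that the null sets can be united.\<close>

lemma (in prob_space) AE_tendsto_zeroI:
  fixes V :: "nat \<Rightarrow> 'a \<Rightarrow> real"
  assumes "\<And>e. e > 0 \<Longrightarrow> AE \<omega> in M. eventually (\<lambda>n. \<bar>V n \<omega>\<bar> \<le> e) sequentially"
  shows "AE \<omega> in M. (\<lambda>n. V n \<omega>) \<longlonglongrightarrow> 0"
proof -
  have "AE \<omega> in M. \<forall>k. eventually (\<lambda>n. \<bar>V n \<omega>\<bar> \<le> inverse (real (Suc k))) sequentially"
    unfolding AE_all_countable by (intro allI assms) simp
  then show ?thesis
  proof eventually_elim
    case (elim \<omega>)
    show ?case
    proof (rule tendstoI)
      fix e :: real assume "e > 0"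
      then obtain k where k: "inverse (real (Suc k)) < e" using reals_Archimedean by blast
      from elim[rule_format, of k] show "eventually (\<lambda>n. dist (V n \<omega>) 0 < e) sequentially"
        by eventually_elim (use k in auto)
    qed
  qed
qed

lemma (in prob_space) AE_eventually_not_if_summable:
  assumes P: "\<And>n. {\<omega> \<in> space M. P n \<omega>} \<in> sets M"
    and s: "summable r" "eventually (\<lambda>n. prob {\<omega> \<in> space M. P n \<omega>} \<le> r n) sequentially"
  shows "AE \<omega> in M. eventually (\<lambda>n. \<not> P n \<omega>) sequentially"
proof -
  have "summable (\<lambda>n. prob {\<omega> \<in> space M. P n \<omega>})"
    by (rule summable_comparison_test_ev[OF _ s(1)]) (use s(2) in simp)
  then have "AE \<omega> in M. eventually (\<lambda>n. \<omega> \<in> space M - {\<omega> \<in> space M. P n \<omega>}) sequentially"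
    using P by (intro borel_cantelli_AE1) (auto simp: emeasure_eq_measure)
  then show ?thesis by eventually_elim (auto elim: eventually_mono)
qed

text \<open>The factor \<open>real n\<close> pays for the union bound over the n training points.
  Where no union bound occurs, it is inserted as an overestimate so that one series serves all
  cases.\<close>

lemma summable_exp_minus_powr:
  fixes c \<beta> :: real
  assumes "c > 0" "\<beta> > 0"
  shows "summable (\<lambda>n. real n * exp (- (c * real n powr \<beta>)))"
proof (rule summable_comparison_test_bigo)
  show "summable (\<lambda>n. norm (1 / real n ^ 2))"
    using inverse_power_summable[of 2] by (simp add: field_simps)
  show "(\<lambda>n. real n * exp (- (c * real n powr \<beta>))) \<in> O(\<lambda>n. 1 / real n ^ 2)"
    using assms by real_asymp
qed

section \<open>Labelled samples\<close>

text \<open>Posteriors enter through an identity tested against bounded functions of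
  \<open>X\<close>, and every \<open>\<eta> j\<close> is measurable with values in [0,1] everywhere.
  Given posteriors satisfy the range condition only almost surely along \<open>X\<close>; the final
  theorem truncates them before interpreting this locale.\<close>

locale labelled_sample = prob_space M
  for M :: "'a measure" +
  fixes X :: "'a \<Rightarrow> real ^ 'd" and Y :: "'a \<Rightarrow> nat"
    and Xs :: "nat \<Rightarrow> 'a \<Rightarrow> real ^ 'd" and Ys :: "nat \<Rightarrow> 'a \<Rightarrow> nat"
    and Q :: nat and f :: "real ^ 'd \<Rightarrow> real" and \<eta> :: "nat \<Rightarrow> real ^ 'd \<Rightarrow> real"
    and fmin fmax :: real
  assumes X_measurable[measurable]: "X \<in> borel_measurable M"
    and Y_measurable[measurable]: "Y \<in> measurable M (count_space UNIV)"
    and indep: "indep_vars (\<lambda>_. borel \<Otimes>\<^sub>M count_space UNIV) (\<lambda>l \<omega>. (Xs l \<omega>, Ys l \<omega>)) {1..}"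
    and copies: "\<And>l. l \<ge> 1 \<Longrightarrow> distr M (borel \<Otimes>\<^sub>M count_space UNIV) (\<lambda>\<omega>. (Xs l \<omega>, Ys l \<omega>)) =
          distr M (borel \<Otimes>\<^sub>M count_space UNIV) (\<lambda>\<omega>. (X \<omega>, Y \<omega>))"
    and f_measurable[measurable]: "f \<in> borel_measurable borel"
    and f_nonneg: "\<And>x. 0 \<le> f x"
    and density: "distributed M lborel X (\<lambda>x. ennreal (f x))"
    and fmin_pos: "0 < fmin"
    and f_bounds: "AE \<omega> in M. fmin \<le> f (X \<omega>) \<and> f (X \<omega>) \<le> fmax"
    and label_range: "AE \<omega> in M. Y \<omega> \<in> {1..Q}"
    and \<eta>_measurable: "\<And>j. \<eta> j \<in> borel_measurable borel"
    and \<eta>_range: "\<And>j x. 0 \<le> \<eta> j x \<and> \<eta> j x \<le> 1"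
    and \<eta>_posterior: "\<And>j k b. j \<in> {1..Q} \<Longrightarrow> k \<in> borel_measurable borel \<Longrightarrow> (\<And>x. \<bar>k x\<bar> \<le> b) \<Longrightarrow>
          expectation (\<lambda>\<omega>. k (X \<omega>) * of_bool (Y \<omega> = j)) = expectation (\<lambda>\<omega>. k (X \<omega>) * \<eta> j (X \<omega>))"
begin

text \<open>Index \<open>0\<close> stands for the union of all classes, so that the numerators and the denominator of
  the soft nearest-neighbour rule are treated alike.\<close>

definition cls :: "nat \<Rightarrow> nat set" where
  "cls j = (if j = 0 then UNIV else {j})"

definition post :: "nat \<Rightarrow> real ^ 'd \<Rightarrow> real" where
  "post j = (if j = 0 then (\<lambda>_. 1) else \<eta> j)"

abbreviation E :: "((real ^ 'd) \<times> nat) measure" where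
  "E \<equiv> borel \<Otimes>\<^sub>M count_space UNIV"

definition Z :: "nat \<Rightarrow> 'a \<Rightarrow> (real ^ 'd) \<times> nat" where
  "Z l \<omega> = (Xs l \<omega>, Ys l \<omega>)"

text \<open>Up to normalisation these are the numerators (\<open>j\<close> in \<open>{1..Q}\<close>)
  and the denominator (\<open>j = 0\<close>) of the rule. The index set is a parameter so that a
  sample point can be left out of its own sum.\<close>

definition wsum :: "real \<Rightarrow> nat set \<Rightarrow> (nat \<Rightarrow> (real ^ 'd) \<times> nat) \<Rightarrow> nat \<Rightarrow> real ^ 'd \<Rightarrow> real" where
  "wsum h I z j x = (\<Sum>m\<in>I. scaled_kernel h (x - fst (z m)) * of_bool (snd (z m) \<in> cls j))"

text \<open>For \<open>j\<close> in \<open>{1..Q}\<close> this is the subdensity of \<open>X\<close>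
  on the event \<open>Y = j\<close>, that is, the class density times the prior probability of the
  class; for \<open>j = 0\<close> it is \<open>f\<close> itself.\<close>

abbreviation joint :: "nat \<Rightarrow> real ^ 'd \<Rightarrow> real" where
  "joint j \<equiv> \<lambda>x. post j x * f x"

text \<open>The bias half of the error: points where every expected kernel average is close to its
  target. The set does not depend on the sample, so the concentration bound applies at each of its
  points.\<close>

definition good :: "real \<Rightarrow> real \<Rightarrow> (real ^ 'd) set" where
  "good h \<delta> = {x. fmin \<le> f x \<and> f x \<le> fmax \<and> (\<forall>j\<le>Q. \<bar>smooth h (joint j) x - joint j x\<bar> \<le> \<delta>)}"

text \<open>The random half of the error: fluctuation of the kernel sums about their means. The
  tolerance refers to \<open>n\<close> and the centring to \<open>card I\<close>, which differ when
  a point is left out.\<close>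

definition deviates :: "nat \<Rightarrow> nat set \<Rightarrow> real \<Rightarrow> real \<Rightarrow> (nat \<Rightarrow> (real ^ 'd) \<times> nat) \<Rightarrow> real ^ 'd \<Rightarrow> bool" where
  "deviates n I h \<delta> z x \<longleftrightarrow>
     (\<exists>j\<le>Q. real n * \<delta> \<le> \<bar>wsum h I z j x - card I * smooth h (joint j) x\<bar>)"

section \<open>Measurability, and passage from sample points to the pair (X,Y)\<close>

lemma post_measurable[measurable]: "post j \<in> borel_measurable borel"
  using \<eta>_measurable[of j] by (cases "j = 0") (simp_all add: post_def)

lemma post_range: "0 \<le> post j x" "post j x \<le> 1"
  using \<eta>_range[of j x] by (auto simp: post_def)

lemma good_sets[measurable]: "good h \<delta> \<in> sets borel"
  unfolding good_def by measurable

lemma Z_measurable[measurable]: "l \<ge> 1 \<Longrightarrow> Z l \<in> measurable M E"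
  using indep unfolding indep_vars_def by (auto simp: Z_def[abs_def])

lemma distr_Z: "l \<ge> 1 \<Longrightarrow> distr M E (Z l) = distr M E (\<lambda>\<omega>. (X \<omega>, Y \<omega>))"
  using copies by (simp add: Z_def[abs_def])

lemma indep_Z: "I \<subseteq> {1..} \<Longrightarrow> indep_vars (\<lambda>_. E) Z I"
  unfolding Z_def[abs_def] by (rule indep_vars_subset[OF indep])

lemma expectation_Z:
  fixes \<phi> :: "(real ^ 'd) \<times> nat \<Rightarrow> real"
  assumes "l \<ge> 1" "\<phi> \<in> borel_measurable E"
  shows "expectation (\<lambda>\<omega>. \<phi> (Z l \<omega>)) = expectation (\<lambda>\<omega>. \<phi> (X \<omega>, Y \<omega>))"
  using integral_distr[OF Z_measurable[OF assms(1)] assms(2)]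
    integral_distr[of "\<lambda>\<omega>. (X \<omega>, Y \<omega>)" M E \<phi>] assms(2) distr_Z[OF assms(1)] by simp

lemma fmax_pos: "0 < fmax"
proof -
  have "AE \<omega> in M. 0 < fmax" using f_bounds by eventually_elim (use fmin_pos in linarith)
  then show ?thesis by simp
qed

lemma expectation_X_density:
  fixes k :: "real ^ 'd \<Rightarrow> real"
  assumes [measurable]: "k \<in> borel_measurable borel"
  shows "expectation (\<lambda>\<omega>. k (X \<omega>)) = (\<integral>x. f x * k x \<partial>lborel)"
  using distributed_integral[OF density, of k] f_nonneg by simp

lemma integrable_f: "integrable lborel f"
  using distributed_integrable[OF density, of "\<lambda>_. 1"] f_nonneg by simp

lemma integrable_joint: "integrable lborel (joint j)"
  by (rule Bochner_Integration.integrable_bound[OF integrable_f])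
     (auto simp: abs_mult post_range f_nonneg intro!: AE_I2 mult_left_le_one_le)

lemma expectation_cls:
  assumes j: "j \<le> Q" and [measurable]: "k \<in> borel_measurable borel" and b: "\<And>x. \<bar>k x\<bar> \<le> b"
  shows "expectation (\<lambda>\<omega>. k (X \<omega>) * of_bool (Y \<omega> \<in> cls j)) = expectation (\<lambda>\<omega>. k (X \<omega>) * post j (X \<omega>))"
  using \<eta>_posterior[of j k b] j b by (cases "j = 0") (auto simp: cls_def post_def)

text \<open>Conditioning on \<open>X\<close> turns the label indicator into the posterior, and
  integrating against \<open>f\<close> gives a convolution.\<close>

lemma expectation_kernel:
  assumes "j \<le> Q" "0 < h"
  shows "expectation (\<lambda>\<omega>. scaled_kernel h (x - X \<omega>) * of_bool (Y \<omega> \<in> cls j)) = smooth h (joint j) x"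
proof -
  have "expectation (\<lambda>\<omega>. scaled_kernel h (x - X \<omega>) * of_bool (Y \<omega> \<in> cls j)) =
      expectation (\<lambda>\<omega>. scaled_kernel h (x - X \<omega>) * post j (X \<omega>))"
    by (rule expectation_cls[OF assms(1), where b="kernel_max TYPE('d) / h ^ CARD('d)"])
       (use assms(2) in \<open>auto simp: abs_of_pos[OF scaled_kernel_pos] scaled_kernel_le\<close>)
  also have "\<dots> = (\<integral>y. f y * (scaled_kernel h (x - y) * post j y) \<partial>lborel)"
    by (rule expectation_X_density) measurable
  finally show ?thesis by (simp add: smooth_def mult_ac)
qed

section \<open>Concentration of sample averages and exceptional points\<close>

lemma sample_concentration:
  fixes \<phi> :: "(real ^ 'd) \<times> nat \<Rightarrow> real"
  assumes I: "finite I" "I \<subseteq> {1..}" "card I \<le> n" and [measurable]: "\<phi> \<in> borel_measurable E"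
    and b: "\<And>z. 0 \<le> \<phi> z \<and> \<phi> z \<le> b" "0 < b"
    and B: "expectation (\<lambda>\<omega>. \<phi> (X \<omega>, Y \<omega>)) \<le> B" and \<delta>: "0 < \<delta>" "\<delta> \<le> B"
  shows "prob {\<omega> \<in> space M. real n * \<delta> \<le> \<bar>(\<Sum>i\<in>I. \<phi> (Z i \<omega>)) - card I * expectation (\<lambda>\<omega>. \<phi> (X \<omega>, Y \<omega>))\<bar>}
    \<le> 2 * exp (- (real n * \<delta>\<^sup>2 / (4 * B * b)))"
proof (rule bernstein_sum[OF I(1) _ _ _ b(2) _ B \<delta>])
  show "indep_vars (\<lambda>_. borel) (\<lambda>i \<omega>. \<phi> (Z i \<omega>)) I"
    by (rule indep_vars_compose2[OF indep_Z[OF I(2)]]) simp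
  show "expectation (\<lambda>\<omega>. \<phi> (Z i \<omega>)) = expectation (\<lambda>\<omega>. \<phi> (X \<omega>, Y \<omega>))" if "i \<in> I" for i
    using that I(2) by (intro expectation_Z) auto
qed (use I b in auto)

text \<open>A strong law for a row-dependent summand \<open>\<phi> n\<close>, as needed for the
  fraction of sample points outside \<open>good (h n) \<delta>\<close>, a set that moves with n. The
  uniform bound \<open>b\<close> makes the Bernstein probabilities summable.\<close>

lemma sample_mean_tendsto:
  fixes \<phi> :: "nat \<Rightarrow> (real ^ 'd) \<times> nat \<Rightarrow> real"
  assumes [measurable]: "\<And>n. \<phi> n \<in> borel_measurable E"
    and b: "\<And>n z. 0 \<le> \<phi> n z \<and> \<phi> n z \<le> b" "0 < b"
  shows "AE \<omega> in M. (\<lambda>n. (\<Sum>l=1..n. \<phi> n (Z l \<omega>)) / n - expectation (\<lambda>\<omega>. \<phi> n (X \<omega>, Y \<omega>))) \<longlonglongrightarrow> 0"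
proof (rule AE_tendsto_zeroI)
  fix e :: real assume "e > 0"
  \<comment> \<open>Large enough to dominate both the means and the tolerance \<open>e\<close>, as
    the concentration bound requires.\<close>
  define B where "B = b + e"
  define \<mu> where "\<mu> n = expectation (\<lambda>\<omega>. \<phi> n (X \<omega>, Y \<omega>))" for n
  have \<mu>: "\<mu> n \<le> B" for n
  proof -
    have "\<mu> n \<le> expectation (\<lambda>_. b)"
      unfolding \<mu>_def by (intro integral_mono integrable_const_bound[of _ b]) (use b in auto)
    then show ?thesis using \<open>e > 0\<close> by (simp add: B_def prob_space)
  qed
  let ?P = "\<lambda>n \<omega>. real n * e \<le> \<bar>(\<Sum>l=1..n. \<phi> n (Z l \<omega>)) - n * \<mu> n\<bar>"
  define c where "c = e\<^sup>2 / (4 * B * b)"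
  have c: "c > 0" using b \<open>e > 0\<close> by (simp add: c_def B_def add_pos_pos)
  have "AE \<omega> in M. eventually (\<lambda>n. \<not> ?P n \<omega>) sequentially"
  proof (rule AE_eventually_not_if_summable)
    show "{\<omega> \<in> space M. ?P n \<omega>} \<in> sets M" for n by measurable
    show "summable (\<lambda>n. 2 * (real n * exp (- (c * real n powr 1))))"
      by (intro summable_mult summable_exp_minus_powr c) simp
    show "eventually (\<lambda>n. prob {\<omega> \<in> space M. ?P n \<omega>} \<le> 2 * (real n * exp (- (c * real n powr 1)))) sequentially"
      using eventually_ge_at_top[of 1]
    proof eventually_elim
      case (elim n)
      have "prob {\<omega> \<in> space M. ?P n \<omega>} \<le> 2 * exp (- (real n * e\<^sup>2 / (4 * B * b)))"
        using sample_concentration[of "{1..n}" n "\<phi> n" b B e] b \<mu>[of n] \<open>e > 0\<close>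
        by (auto simp: \<mu>_def[symmetric] B_def)
      also have "real n * e\<^sup>2 / (4 * B * b) = c * real n powr 1" using elim by (simp add: c_def)
      also have "2 * exp (- (c * real n powr 1)) \<le> 2 * (real n * exp (- (c * real n powr 1)))"
        using elim by simp
      finally show ?case .
    qed
  qed
  then show "AE \<omega> in M. eventually (\<lambda>n. \<bar>(\<Sum>l=1..n. \<phi> n (Z l \<omega>)) / n - expectation (\<lambda>\<omega>. \<phi> n (X \<omega>, Y \<omega>))\<bar> \<le> e) sequentially"
  proof eventually_elim
    case (elim \<omega>)
    show ?case using elim eventually_gt_at_top[of 0]
    proof eventually_elim
      case (elim n)
      have "\<bar>((\<Sum>l=1..n. \<phi> n (Z l \<omega>)) - n * \<mu> n) / n\<bar> \<le> e"
        using elim by (simp add: abs_divide divide_le_eq mult.commute)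
      then show ?case using elim by (simp add: \<mu>_def[symmetric] diff_divide_distrib)
    qed
  qed
qed

text \<open>Where \<open>f\<close> is at most \<open>fmax\<close> and the smoothing error exceeds
  \<delta>, the density is at most \<open>fmax / \<delta>\<close> times that error. Hence the
  probability is controlled by the L1 smoothing error, which tends to 0, and finitely many indices
  \<open>j\<close> are summed.\<close>

lemma prob_not_good:
  assumes h: "eventually (\<lambda>n. 0 < h n) sequentially" "h \<longlonglongrightarrow> 0" and \<delta>: "0 < \<delta>"
  shows "(\<lambda>n. prob {\<omega> \<in> space M. X \<omega> \<notin> good (h n) \<delta>}) \<longlonglongrightarrow> 0"
proof -
  define u where "u n j x = smooth (h n) (joint j) x - joint j x" for n j x
  have [measurable]: "u n j \<in> borel_measurable borel" for n j unfolding u_def[abs_def] by measurable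
  have one: "(\<lambda>n. prob {\<omega> \<in> space M. f (X \<omega>) \<le> fmax \<and> \<delta> < \<bar>u n j (X \<omega>)\<bar>}) \<longlonglongrightarrow> 0" for j
  proof -
    have "emeasure M {\<omega> \<in> space M. f (X \<omega>) \<le> fmax \<and> \<delta> < \<bar>u n j (X \<omega>)\<bar>} \<le>
        ennreal (fmax / \<delta>) * (\<integral>\<^sup>+x. ennreal \<bar>u n j x\<bar> \<partial>lborel)" for n
    proof -
      have "{\<omega> \<in> space M. f (X \<omega>) \<le> fmax \<and> \<delta> < \<bar>u n j (X \<omega>)\<bar>} =
          X -` {x. f x \<le> fmax \<and> \<delta> < \<bar>u n j x\<bar>} \<inter> space M" by auto
      then have "emeasure M {\<omega> \<in> space M. f (X \<omega>) \<le> fmax \<and> \<delta> < \<bar>u n j (X \<omega>)\<bar>} =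
          (\<integral>\<^sup>+x. ennreal (f x) * indicator {x. f x \<le> fmax \<and> \<delta> < \<bar>u n j x\<bar>} x \<partial>lborel)"
        using distributed_emeasure[OF density, of "{x. f x \<le> fmax \<and> \<delta> < \<bar>u n j x\<bar>}"] by simp
      also have "\<dots> \<le> (\<integral>\<^sup>+x. ennreal (fmax / \<delta>) * ennreal \<bar>u n j x\<bar> \<partial>lborel)"
      proof (intro nn_integral_mono)
        fix x
        have "f x \<le> fmax / \<delta> * \<bar>u n j x\<bar>" if "f x \<le> fmax" "\<delta> < \<bar>u n j x\<bar>"
        proof -
          have "fmax * \<delta> \<le> fmax * \<bar>u n j x\<bar>" using that fmax_pos by (intro mult_left_mono) auto
          moreover have "f x * \<delta> \<le> fmax * \<delta>" using that \<delta> by (intro mult_right_mono) auto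
          ultimately have "f x * \<delta> \<le> fmax * \<bar>u n j x\<bar>" by linarith
          then show ?thesis using \<delta> by (simp add: pos_le_divide_eq)
        qed
        moreover have c: "0 \<le> fmax / \<delta>" using fmax_pos \<delta> by simp
        ultimately show "ennreal (f x) * indicator {x. f x \<le> fmax \<and> \<delta> < \<bar>u n j x\<bar>} x \<le>
            ennreal (fmax / \<delta>) * ennreal \<bar>u n j x\<bar>"
          by (cases "f x \<le> fmax \<and> \<delta> < \<bar>u n j x\<bar>")
             (simp_all add: c ennreal_mult'[symmetric, of "fmax / \<delta>"] ennreal_leI del: ennreal_mult')
      qed
      also have "\<dots> = ennreal (fmax / \<delta>) * (\<integral>\<^sup>+x. ennreal \<bar>u n j x\<bar> \<partial>lborel)"
        by (rule nn_integral_cmult) simp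
      finally show ?thesis .
    qed
    note le = this
    have "(\<lambda>n. ennreal (fmax / \<delta>) * (\<integral>\<^sup>+x. ennreal \<bar>u n j x\<bar> \<partial>lborel)) \<longlonglongrightarrow> ennreal (fmax / \<delta>) * 0"
      unfolding u_def by (intro ennreal_tendsto_cmult smooth_tendsto_L1 integrable_joint h) simp
    then have lim: "(\<lambda>n. ennreal (fmax / \<delta>) * (\<integral>\<^sup>+x. ennreal \<bar>u n j x\<bar> \<partial>lborel)) \<longlonglongrightarrow> 0" by simp
    have "(\<lambda>n. emeasure M {\<omega> \<in> space M. f (X \<omega>) \<le> fmax \<and> \<delta> < \<bar>u n j (X \<omega>)\<bar>}) \<longlonglongrightarrow> 0"
      by (rule tendsto_sandwich[OF _ _ tendsto_const lim]) (simp_all add: le)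
    then show ?thesis by (simp add: emeasure_eq_measure ennreal_tendsto_0_iff)
  qed
  have sum0: "(\<lambda>n. \<Sum>j\<le>Q. prob {\<omega> \<in> space M. f (X \<omega>) \<le> fmax \<and> \<delta> < \<bar>u n j (X \<omega>)\<bar>}) \<longlonglongrightarrow> 0"
    by (intro tendsto_null_sum one)
  have "prob {\<omega> \<in> space M. X \<omega> \<notin> good (h n) \<delta>} \<le>
      (\<Sum>j\<le>Q. prob {\<omega> \<in> space M. f (X \<omega>) \<le> fmax \<and> \<delta> < \<bar>u n j (X \<omega>)\<bar>})" for n
  proof -
    have "prob {\<omega> \<in> space M. X \<omega> \<notin> good (h n) \<delta>} \<le>
        prob (\<Union>j\<le>Q. {\<omega> \<in> space M. f (X \<omega>) \<le> fmax \<and> \<delta> < \<bar>u n j (X \<omega>)\<bar>})"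
    proof (rule finite_measure_mono_AE)
      show "AE \<omega> in M. \<omega> \<in> {\<omega> \<in> space M. X \<omega> \<notin> good (h n) \<delta>} \<longrightarrow>
          \<omega> \<in> (\<Union>j\<le>Q. {\<omega> \<in> space M. f (X \<omega>) \<le> fmax \<and> \<delta> < \<bar>u n j (X \<omega>)\<bar>})"
        using f_bounds by eventually_elim (auto simp: good_def u_def not_le)
    qed measurable
    also have "\<dots> \<le> (\<Sum>j\<le>Q. prob {\<omega> \<in> space M. f (X \<omega>) \<le> fmax \<and> \<delta> < \<bar>u n j (X \<omega>)\<bar>})"
      by (intro measure_UNION_le) auto
    finally show ?thesis .
  qed
  then show ?thesis by (intro tendsto_sandwich[OF _ _ tendsto_const sum0] always_eventually) simp_all
qed

text \<open>The Bernstein exponent divided by n h^d, for summands bounded by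
  \<open>kernel_max\<close> over h^d and means bounded by \<open>fmax + \<delta>\<close>.\<close>

definition rate :: "real \<Rightarrow> real" where
  "rate \<delta> = \<delta>\<^sup>2 / (4 * (fmax + \<delta>) * kernel_max TYPE('d))"

lemma rate_pos: "0 < \<delta> \<Longrightarrow> 0 < rate \<delta>"
  using fmax_pos kernel_max_pos[where 'd='d] by (simp add: rate_def add_pos_pos)

text \<open>At a good point the mean of a summand is at most \<open>f x + \<delta>\<close>, hence at
  most \<open>fmax + \<delta>\<close> whatever the bandwidth. The factor \<open>Q + 1\<close> is the
  union bound over the indices 0 to Q.\<close>

lemma prob_deviates:
  assumes x: "x \<in> good h \<delta>" and h: "0 < h" and \<delta>: "0 < \<delta>"
    and I: "finite I" "I \<subseteq> {1..}" "card I \<le> n"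
  shows "prob {\<omega> \<in> space M. deviates n I h \<delta> (\<lambda>m. Z m \<omega>) x} \<le>
    (Q + 1) * (2 * exp (- (rate \<delta> * (real n * h ^ CARD('d)))))"
proof -
  define b where "b = kernel_max TYPE('d) / h ^ CARD('d)"
  have b: "b > 0" using h kernel_max_pos[where 'd='d] by (simp add: b_def)
  let ?\<phi> = "\<lambda>j z. scaled_kernel h (x - fst z) * of_bool (snd z \<in> cls j) :: real"
  let ?A = "\<lambda>j. {\<omega> \<in> space M. real n * \<delta> \<le> \<bar>(\<Sum>m\<in>I. ?\<phi> j (Z m \<omega>)) - card I * smooth h (joint j) x\<bar>}"
  have ZI[measurable]: "Z m \<in> measurable M E" if "m \<in> I" for m using that I(2) by auto
  have [measurable]: "?\<phi> j \<in> borel_measurable E" for j by measurable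
  have [measurable]: "(\<lambda>\<omega>. \<Sum>m\<in>I. ?\<phi> j (Z m \<omega>)) \<in> borel_measurable M" for j
    by (rule borel_measurable_sum, rule measurable_compose[OF ZI]) auto
  have A: "?A j \<in> sets M" for j by measurable
  have one: "prob (?A j) \<le> 2 * exp (- (rate \<delta> * (real n * h ^ CARD('d))))" if j: "j \<le> Q" for j
  proof -
    have f: "\<bar>smooth h (joint j) x - joint j x\<bar> \<le> \<delta>" "f x \<le> fmax"
      using x j by (auto simp: good_def)
    have "joint j x \<le> f x" by (simp add: mult_left_le_one_le post_range f_nonneg)
    then have B: "smooth h (joint j) x \<le> fmax + \<delta>" using f by linarith
    have \<phi>: "0 \<le> ?\<phi> j z \<and> ?\<phi> j z \<le> b" for z
      using scaled_kernel_le[OF h, of "x - fst z"] scaled_kernel_pos[OF h, of "x - fst z"] b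
      unfolding b_def by (cases "snd z \<in> cls j") simp_all
    have "prob (?A j) \<le> 2 * exp (- (real n * \<delta>\<^sup>2 / (4 * (fmax + \<delta>) * b)))"
    proof -
      have e: "expectation (\<lambda>\<omega>. ?\<phi> j (X \<omega>, Y \<omega>)) = smooth h (joint j) x"
        by (simp add: expectation_kernel[OF j h])
      show ?thesis
        by (rule sample_concentration[OF I, where \<phi>="?\<phi> j", unfolded e])
           (measurable, rule \<phi>, rule b, rule B, rule \<delta>, use fmax_pos in linarith)
    qed
    also have "real n * \<delta>\<^sup>2 / (4 * (fmax + \<delta>) * b) = rate \<delta> * (real n * h ^ CARD('d))"
      by (simp add: rate_def b_def)
    finally show ?thesis .
  qed
  have eq: "{\<omega> \<in> space M. deviates n I h \<delta> (\<lambda>m. Z m \<omega>) x} = (\<Union>j\<le>Q. ?A j)"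
    unfolding deviates_def wsum_def by blast
  have "prob {\<omega> \<in> space M. deviates n I h \<delta> (\<lambda>m. Z m \<omega>) x} \<le> (\<Sum>j\<le>Q. prob (?A j))"
    unfolding eq by (rule measure_UNION_le) (simp, rule A)
  also have "\<dots> \<le> (\<Sum>j\<le>Q. 2 * exp (- (rate \<delta> * (real n * h ^ CARD('d)))))"
    by (rule sum_mono, rule one) simp
  also have "\<dots> = (Q + 1) * (2 * exp (- (rate \<delta> * (real n * h ^ CARD('d)))))"
    unfolding sum_constant card_atMost by (simp only: Suc_eq_plus1)
  finally show ?thesis .
qed

text \<open>The space \<open>N\<close> is arbitrary because the evaluation point and the sample will
  live on different factors of a product space.\<close>

lemma deviates_measurable:
  assumes [measurable]: "X' \<in> borel_measurable N" and "\<And>m. m \<in> I \<Longrightarrow> Z' m \<in> measurable N E"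
  shows "Measurable.pred N (\<lambda>p. deviates n I h \<delta> (\<lambda>m. Z' m p) (X' p))"
proof -
  note [measurable] = assms(2)
  have [measurable]: "(\<lambda>p. wsum h I (\<lambda>m. Z' m p) j (X' p)) \<in> borel_measurable N" for j
    unfolding wsum_def by (rule borel_measurable_sum) measurable
  show ?thesis unfolding deviates_def by measurable
qed

end

section \<open>The risk of the soft nearest-neighbour rule\<close>

lemma sum_pairs_symmetric:
  fixes a :: "nat \<Rightarrow> nat \<Rightarrow> real"
  assumes "\<And>l. a l l = 0"
  shows "(\<Sum>l=1..n. \<Sum>m=l+1..n. a l m + a m l) = (\<Sum>l=1..n. \<Sum>m=1..n. a l m)"
proof (induction n)
  case (Suc n)
  have "(\<Sum>l=1..Suc n. \<Sum>m=l+1..Suc n. a l m + a m l) = (\<Sum>l=1..n. \<Sum>m=l+1..Suc n. a l m + a m l)"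
    by simp
  also have "\<dots> = (\<Sum>l=1..n. (\<Sum>m=l+1..n. a l m + a m l) + (a l (Suc n) + a (Suc n) l))"
    by (intro sum.cong refl) auto
  also have "\<dots> = (\<Sum>l=1..n. \<Sum>m=1..n. a l m) + ((\<Sum>l=1..n. a l (Suc n)) + (\<Sum>l=1..n. a (Suc n) l))"
    unfolding sum.distrib[of "\<lambda>l. \<Sum>m=l+1..n. a l m + a m l"] Suc.IH by (simp only: sum.distrib)
  also have "\<dots> = (\<Sum>l=1..Suc n. \<Sum>m=1..Suc n. a l m)"
    using assms by (simp add: sum.distrib)
  finally show ?case .
qed simp

text \<open>The pairwise sum is the resubstitution error of the soft nearest-neighbour rule: a point does not
  contribute to its own error because \<open>theta\<close> vanishes on the diagonal.\<close>

lemma pair_sum_eq_resubstitution: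
  fixes x :: "nat \<Rightarrow> real ^ 'd"
  assumes h: "0 < h" and y: "\<And>l. l \<in> {1..n} \<Longrightarrow> y l \<in> {1..Q}"
  shows "(1 / (real n)\<^sup>2) * (\<Sum>l=1..n. \<Sum>m=l+1..n. theta y l m * pair_weight x n h l m) =
    (\<Sum>l=1..n. \<Sum>j\<in>{1..Q}. of_bool (y l \<noteq> j) * soft_nn x y n h (x l) j) / n"
proof (cases "n = 0")
  case False
  \<comment> \<open>The contribution of the point \<open>m\<close> to the error at the point
    \<open>l\<close>: the two reciprocals in \<open>pair_weight\<close> are separated according to
    the point at which the density is estimated.\<close>
  define a where "a l m = theta y l m * scaled_kernel h (x l - x m) / kde x n h (x l)" for l m
  have "theta y l m * pair_weight x n h l m = a l m + a m l" for l m
    using scaled_kernel_minus[of h "x m - x l"]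
    by (simp add: a_def pair_weight_def theta_def field_simps)
  then have "(\<Sum>l=1..n. \<Sum>m=l+1..n. theta y l m * pair_weight x n h l m) = (\<Sum>l=1..n. \<Sum>m=l+1..n. a l m + a m l)"
    by simp
  also have "\<dots> = (\<Sum>l=1..n. \<Sum>m=1..n. a l m)"
    by (rule sum_pairs_symmetric) (simp add: a_def theta_def)
  also have "\<dots> = (\<Sum>l=1..n. n * (\<Sum>j\<in>{1..Q}. of_bool (y l \<noteq> j) * soft_nn x y n h (x l) j))"
  proof (intro sum.cong refl)
    fix l assume "l \<in> {1..n}"
    define D where "D = (\<Sum>m=1..n. scaled_kernel h (x l - x m))"
    \<comment> \<open>Since every label lies in \<open>{1..Q}\<close>, the event of differing labels
      splits according to the class \<open>j\<close> of the second point.\<close>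
    have th: "theta y l m = (\<Sum>j\<in>{1..Q}. of_bool (y l \<noteq> j) * of_bool (y m = j))" if "m \<in> {1..n}" for m
    proof -
      have "(\<Sum>j\<in>{1..Q}. of_bool (y l \<noteq> j) * of_bool (y m = j)) = (\<Sum>j\<in>{1..Q}. if j = y m then of_bool (y l \<noteq> y m) else 0 :: real)"
        by (intro sum.cong) auto
      then show ?thesis using y[OF that] by (simp add: theta_def)
    qed
    have "(\<Sum>m=1..n. a l m) = (\<Sum>m=1..n. \<Sum>j\<in>{1..Q}. n * (of_bool (y l \<noteq> j) * (scaled_kernel h (x l - x m) * of_bool (y m = j) / D)))"
    proof (intro sum.cong refl)
      fix m assume m: "m \<in> {1..n}"
      \<comment> \<open>The density estimate is \<open>D\<close> divided by n. The resulting factor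
        n cancels one of the two in the prefactor of the pairwise sum.\<close>
      have "a l m = n * (theta y l m * scaled_kernel h (x l - x m) / D)"
        using False by (simp add: a_def kde_def D_def)
      then show "a l m = (\<Sum>j\<in>{1..Q}. n * (of_bool (y l \<noteq> j) * (scaled_kernel h (x l - x m) * of_bool (y m = j) / D)))"
        by (simp only: th[OF m] sum_distrib_right sum_distrib_left sum_divide_distrib times_divide_eq_right mult_ac)
    qed
    also have "\<dots> = (\<Sum>j\<in>{1..Q}. n * (of_bool (y l \<noteq> j) * ((\<Sum>m=1..n. scaled_kernel h (x l - x m) * of_bool (y m = j)) / D)))"
      by (subst sum.swap) (simp only: sum_distrib_left sum_divide_distrib)
    finally show "(\<Sum>m=1..n. a l m) = n * (\<Sum>j\<in>{1..Q}. of_bool (y l \<noteq> j) * soft_nn x y n h (x l) j)"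
      by (simp add: soft_nn_def D_def sum_distrib_left)
  qed
  finally show ?thesis using False by (simp add: sum_distrib_left[symmetric] power2_eq_square)
qed simp

lemma soft_nn_range:
  assumes "0 < h"
  shows "0 \<le> soft_nn x y n h u j" "soft_nn x y n h u j \<le> 1"
proof -
  have K: "0 \<le> scaled_kernel h v" for v :: "real ^ 'd" using scaled_kernel_pos[OF assms, of v] by simp
  have "(\<Sum>l=1..n. scaled_kernel h (u - x l) * of_bool (y l = j)) \<le> (\<Sum>l=1..n. scaled_kernel h (u - x l))"
    by (intro sum_mono) (use K in auto)
  moreover have "0 \<le> (\<Sum>l=1..n. scaled_kernel h (u - x l) * of_bool (y l = j))"
    by (intro sum_nonneg) (use K in auto)
  ultimately show "0 \<le> soft_nn x y n h u j" "soft_nn x y n h u j \<le> 1"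
    by (auto simp: soft_nn_def divide_le_eq_1)
qed

context labelled_sample
begin

section \<open>Convergence of the risk at a new point\<close>

definition risk_limit :: real where
  "risk_limit = (\<Sum>i\<in>{1..Q}. \<Sum>j\<in>{1..Q} - {i}. expectation (\<lambda>\<omega>. \<eta> i (X \<omega>) * \<eta> j (X \<omega>)))"

abbreviation nn :: "nat \<Rightarrow> real \<Rightarrow> 'a \<Rightarrow> real ^ 'd \<Rightarrow> nat \<Rightarrow> real" where
  "nn n h \<omega> \<equiv> soft_nn (\<lambda>l. Xs l \<omega>) (\<lambda>l. Ys l \<omega>) n h"

lemma Xs_Ys_measurable:
  assumes "l \<ge> 1"
  shows "Xs l \<in> borel_measurable M" "Ys l \<in> measurable M (count_space UNIV)"
  using measurable_compose[OF Z_measurable[OF assms] measurable_fst]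
    measurable_compose[OF Z_measurable[OF assms] measurable_snd] by (auto simp: Z_def)

lemma nn_measurable:
  assumes [measurable]: "U \<in> borel_measurable N" "W \<in> measurable N M"
  shows "(\<lambda>p. nn n h (W p) (U p) j) \<in> borel_measurable N"
proof -
  have [measurable]: "(\<lambda>p. Xs l (W p)) \<in> borel_measurable N" "(\<lambda>p. Ys l (W p)) \<in> measurable N (count_space UNIV)"
    if "l \<in> {1..n}" for l
    using that Xs_Ys_measurable[of l] measurable_compose[OF assms(2)] by auto
  show ?thesis unfolding soft_nn_def
    by (intro borel_measurable_divide borel_measurable_sum) measurable
qed

text \<open>With N_j and N_0 for numerator and denominator, the error of N_j / N_0 is the sum of N_j
  - n \<eta>_j f and (n f - N_0) N_j / N_0, divided by n f. As the ratio lies in [0,1], the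
  denominator error is not amplified, and only \<open>f\<close>, not the random N_0, has to be
  bounded below.\<close>

lemma nn_close:
  assumes x: "fmin \<le> f x" and h: "0 < h" and n: "n \<ge> 1" and j: "j \<in> {1..Q}"
    and close: "\<And>j. j \<le> Q \<Longrightarrow> \<bar>wsum h {1..n} (\<lambda>m. Z m \<omega>) j x - n * joint j x\<bar> \<le> n * \<epsilon>"
  shows "\<bar>nn n h \<omega> x j - \<eta> j x\<bar> \<le> 2 * \<epsilon> / fmin"
proof -
  define N where "N i = wsum h {1..n} (\<lambda>m. Z m \<omega>) i x" for i
  have nn: "nn n h \<omega> x j = N j / N 0"
    using j by (simp add: soft_nn_def N_def wsum_def Z_def cls_def)
  have N0: "N 0 > 0"
    using n h unfolding N_def wsum_def by (intro sum_pos) (auto simp: cls_def scaled_kernel_pos)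
  have r: "0 \<le> N j / N 0" "N j / N 0 \<le> 1" using soft_nn_range[OF h] nn by metis+
  have fx: "f x > 0" using x fmin_pos by simp
  have nf: "n * f x > 0" using fx n by simp
  have \<epsilon>: "0 \<le> n * \<epsilon>" using close[of 0] by linarith
  have "N j / N 0 - \<eta> j x = ((N j - n * joint j x) + (n * joint 0 x - N 0) * (N j / N 0)) / (n * f x)"
    using N0 fx n j by (simp add: post_def field_simps)
  then have "\<bar>N j / N 0 - \<eta> j x\<bar> = \<bar>(N j - n * joint j x) + (n * joint 0 x - N 0) * (N j / N 0)\<bar> / (n * f x)"
    using nf by (simp add: abs_divide)
  also have "\<dots> \<le> (n * \<epsilon> + n * \<epsilon>) / (n * f x)"
  proof (rule divide_right_mono)
    have "\<bar>(n * joint 0 x - N 0) * (N j / N 0)\<bar> \<le> n * \<epsilon> * 1"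
      unfolding abs_mult using close[of 0] r \<epsilon> by (intro mult_mono) (auto simp: N_def abs_minus_commute)
    then have b: "\<bar>(n * joint 0 x - N 0) * (N j / N 0)\<bar> \<le> n * \<epsilon>" by simp
    have a: "\<bar>N j - n * joint j x\<bar> \<le> n * \<epsilon>" using close[of j] j by (simp add: N_def)
    show "\<bar>(N j - n * joint j x) + (n * joint 0 x - N 0) * (N j / N 0)\<bar> \<le> n * \<epsilon> + n * \<epsilon>"
      by (rule order.trans[OF abs_triangle_ineq add_mono[OF a b]])
  qed (use nf in simp)
  also have "\<dots> = 2 * \<epsilon> / f x" using n by (simp add: field_simps)
  also have "\<dots> \<le> 2 * \<epsilon> / fmin"
    using x fmin_pos \<epsilon> n by (intro divide_left_mono) (auto simp: zero_le_mult_iff)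
  finally show ?thesis by (simp add: nn)
qed

text \<open>One \<delta> accounts for the fluctuation of the sum, the other for the smoothing
  bias.\<close>

lemma wsum_close_joint:
  assumes x: "x \<in> good h \<delta>" and dev: "\<not> deviates n I h \<delta> z x" and j: "j \<le> Q"
    and I: "card I \<le> n" and \<delta>: "0 < \<delta>"
  shows "\<bar>wsum h I z j x - card I * joint j x\<bar> \<le> n * (2 * \<delta>)"
proof -
  have "\<bar>wsum h I z j x - card I * smooth h (joint j) x\<bar> \<le> n * \<delta>"
    using dev j unfolding deviates_def by force
  moreover have "\<bar>card I * (smooth h (joint j) x - joint j x)\<bar> \<le> n * \<delta>"
    unfolding abs_mult using x j I \<delta> by (intro mult_mono) (auto simp: good_def)
  ultimately show ?thesis by (simp add: algebra_simps)
qed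

text \<open>Here \<open>\<omega>\<close> carries the training data and \<open>\<xi>\<close> a fresh
  draw. For each fixed good point the sample deviates with exponentially small probability.
  Exchanging the integrals bounds the mean over \<open>\<omega>\<close> of the deviating mass,
  Markov's inequality turns this into a tail bound at level \<open>e\<close>, and that bound is
  summable in n.\<close>

lemma new_point_deviates:
  fixes h :: "nat \<Rightarrow> real"
  assumes h: "eventually (\<lambda>n. 0 < h n) sequentially"
    and \<beta>: "0 < \<beta>" "eventually (\<lambda>n. real n powr \<beta> \<le> n * h n ^ CARD('d)) sequentially"
    and \<delta>: "0 < \<delta>" and e: "0 < e"
  shows "AE \<omega> in M. eventually (\<lambda>n. prob {\<xi> \<in> space M. X \<xi> \<in> good (h n) \<delta> \<and>
      deviates n {1..n} (h n) \<delta> (\<lambda>m. Z m \<omega>) (X \<xi>)} < e) sequentially"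
proof -
  interpret MM: pair_sigma_finite M M ..
  define D where "D n \<xi> \<omega> \<longleftrightarrow> X \<xi> \<in> good (h n) \<delta> \<and> deviates n {1..n} (h n) \<delta> (\<lambda>m. Z m \<omega>) (X \<xi>)" for n \<xi> \<omega>
  have pred: "Measurable.pred (M \<Otimes>\<^sub>M M) (\<lambda>p. D n (fst p) (snd p))" for n
  proof -
    have [measurable]: "Measurable.pred (M \<Otimes>\<^sub>M M) (\<lambda>p. deviates n {1..n} (h n) \<delta> (\<lambda>m. Z m (snd p)) (X (fst p)))"
      by (rule deviates_measurable) (auto intro!: measurable_compose[OF measurable_snd Z_measurable])
    show ?thesis unfolding D_def by measurable
  qed
  have pred1: "Measurable.pred M (\<lambda>\<xi>. D n \<xi> \<omega>)" if "\<omega> \<in> space M" for n \<omega>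
    using measurable_compose[OF measurable_Pair2'[OF that] pred] by simp
  have pred2: "Measurable.pred M (\<lambda>\<omega>. D n \<xi> \<omega>)" if "\<xi> \<in> space M" for n \<xi>
    using measurable_compose[OF measurable_Pair1'[OF that] pred] by simp
  \<comment> \<open>Written as a section integral on the product, so that measurability in
    \<open>\<omega>\<close> follows from Fubini; it is the probability in question for
    \<open>\<omega>\<close> in \<open>space M\<close>.\<close>
  define U where "U n \<omega> = (\<integral>\<^sup>+\<xi>. indicator {p. D n (fst p) (snd p)} (\<xi>, \<omega>) \<partial>M)" for n \<omega>
  have ind[measurable]: "(\<lambda>p. indicator {p. D n (fst p) (snd p)} p :: ennreal) \<in> borel_measurable (M \<Otimes>\<^sub>M M)" for n
    using pred[of n] by (intro borel_measurable_indicator') (simp add: pred_def)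
  have U_measurable[measurable]: "U n \<in> borel_measurable M" for n
    unfolding U_def by measurable
  have U: "U n \<omega> = emeasure M {\<xi> \<in> space M. D n \<xi> \<omega>}" if "\<omega> \<in> space M" for n \<omega>
  proof -
    have "U n \<omega> = (\<integral>\<^sup>+\<xi>. indicator {\<xi> \<in> space M. D n \<xi> \<omega>} \<xi> \<partial>M)"
      unfolding U_def by (intro nn_integral_cong) (auto simp: indicator_def)
    also have "\<dots> = emeasure M {\<xi> \<in> space M. D n \<xi> \<omega>}"
      using pred1[OF that, of n] by (intro nn_integral_indicator) (simp add: pred_def)
    finally show ?thesis .
  qed
  have EU: "(\<integral>\<^sup>+\<omega>. U n \<omega> \<partial>M) \<le> ennreal ((Q + 1) * (2 * exp (- (rate \<delta> * (real n * h n ^ CARD('d))))))"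
    if "0 < h n" for n
  proof -
    let ?r = "(Q + 1) * (2 * exp (- (rate \<delta> * (real n * h n ^ CARD('d)))))"
    have "(\<integral>\<^sup>+\<omega>. U n \<omega> \<partial>M) = (\<integral>\<^sup>+\<xi>. \<integral>\<^sup>+\<omega>. indicator {p. D n (fst p) (snd p)} (\<xi>, \<omega>) \<partial>M \<partial>M)"
      unfolding U_def by (rule MM.Fubini) simp
    also have "\<dots> \<le> (\<integral>\<^sup>+\<xi>. ennreal ?r \<partial>M)"
    proof (rule nn_integral_mono)
      fix \<xi> assume \<xi>: "\<xi> \<in> space M"
      have "(\<integral>\<^sup>+\<omega>. indicator {p. D n (fst p) (snd p)} (\<xi>, \<omega>) \<partial>M) = (\<integral>\<^sup>+\<omega>. indicator {\<omega> \<in> space M. D n \<xi> \<omega>} \<omega> \<partial>M)"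
        by (intro nn_integral_cong) (auto simp: indicator_def)
      also have "\<dots> = emeasure M {\<omega> \<in> space M. D n \<xi> \<omega>}"
        using pred2[OF \<xi>, of n] by (intro nn_integral_indicator) (simp add: pred_def)
      also have "\<dots> \<le> ennreal ?r"
      proof (cases "X \<xi> \<in> good (h n) \<delta>")
        case True
        then show ?thesis
          using prob_deviates[OF True that \<delta>, of "{1..n}" n] by (auto simp: D_def emeasure_eq_measure intro!: ennreal_leI)
      qed (simp add: D_def)
      finally show "(\<integral>\<^sup>+\<omega>. indicator {p. D n (fst p) (snd p)} (\<xi>, \<omega>) \<partial>M) \<le> ennreal ?r" .
    qed
    finally show ?thesis by (simp add: emeasure_space_1)
  qed
  \<comment> \<open>The constant 2 (Q + 1) of the concentration bound times the factor 1/e of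
    Markov's inequality.\<close>
  define C where "C = (Q + 1) * 2 / e"
  have C: "C > 0" using e by (simp add: C_def)
  have "AE \<omega> in M. eventually (\<lambda>n. \<not> ennreal e \<le> U n \<omega>) sequentially"
  proof (rule AE_eventually_not_if_summable)
    show "summable (\<lambda>n. C * (real n * exp (- (rate \<delta> * real n powr \<beta>))))"
      by (intro summable_mult summable_exp_minus_powr rate_pos \<delta> \<beta>)
    show "eventually (\<lambda>n. prob {\<omega> \<in> space M. ennreal e \<le> U n \<omega>} \<le> C * (real n * exp (- (rate \<delta> * real n powr \<beta>)))) sequentially"
      using h \<beta>(2) eventually_ge_at_top[of 1]
    proof eventually_elim
      case (elim n)
      have "emeasure M {\<omega> \<in> space M. ennreal e \<le> U n \<omega>} = emeasure M {\<omega> \<in> space M. 1 \<le> ennreal (1 / e) * U n \<omega>}"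
      proof -
        have "ennreal e \<le> u \<longleftrightarrow> 1 \<le> ennreal (1 / e) * u" for u :: ennreal
        proof -
          have *: "ennreal (1 / e) * ennreal e = 1" "ennreal e * ennreal (1 / e) = 1"
            using e by (simp_all add: ennreal_mult'[symmetric])
          show ?thesis
          proof
            assume "ennreal e \<le> u"
            then show "1 \<le> ennreal (1 / e) * u" using mult_left_mono[of "ennreal e" u "ennreal (1 / e)"] * by simp
          next
            assume "1 \<le> ennreal (1 / e) * u"
            then show "ennreal e \<le> u"
              using mult_left_mono[of 1 "ennreal (1 / e) * u" "ennreal e"] * by (simp add: mult.assoc[symmetric])
          qed
        qed
        then show ?thesis by simp
      qed
      also have "\<dots> \<le> ennreal (1 / e) * (\<integral>\<^sup>+\<omega>. U n \<omega> * indicator (space M) \<omega> \<partial>M)"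
        using nn_integral_Markov_inequality[of "U n" "space M" M "ennreal (1 / e)"] by simp
      also have "(\<integral>\<^sup>+\<omega>. U n \<omega> * indicator (space M) \<omega> \<partial>M) = (\<integral>\<^sup>+\<omega>. U n \<omega> \<partial>M)"
        by (intro nn_integral_cong) simp
      also have "ennreal (1 / e) * \<dots> \<le> ennreal (1 / e) * ennreal ((Q + 1) * (2 * exp (- (rate \<delta> * (real n * h n ^ CARD('d))))))"
        by (intro mult_left_mono EU elim) simp
      also have "\<dots> = ennreal (C * exp (- (rate \<delta> * (real n * h n ^ CARD('d)))))"
        using e by (simp add: ennreal_mult'[symmetric] C_def)
      finally have "prob {\<omega> \<in> space M. ennreal e \<le> U n \<omega>} \<le> C * exp (- (rate \<delta> * (real n * h n ^ CARD('d))))"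
        using C by (simp add: emeasure_eq_measure)
      also have "\<dots> \<le> C * exp (- (rate \<delta> * real n powr \<beta>))"
        using elim rate_pos[OF \<delta>] C by simp
      also have "\<dots> \<le> C * (real n * exp (- (rate \<delta> * real n powr \<beta>)))"
        using elim C by simp
      finally show ?case .
    qed
  qed measurable
  then show ?thesis
  proof (rule AE_mp, intro AE_I2 impI)
    fix \<omega> assume "\<omega> \<in> space M" and "eventually (\<lambda>n. \<not> ennreal e \<le> U n \<omega>) sequentially"
    then show "eventually (\<lambda>n. prob {\<xi> \<in> space M. X \<xi> \<in> good (h n) \<delta> \<and>
      deviates n {1..n} (h n) \<delta> (\<lambda>m. Z m \<omega>) (X \<xi>)} < e) sequentially"
      by (elim eventually_mono) (simp add: U emeasure_eq_measure D_def not_le ennreal_less_iff)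
  qed
qed

lemma nn_L1_tendsto:
  fixes h :: "nat \<Rightarrow> real"
  assumes h: "eventually (\<lambda>n. 0 < h n) sequentially" "h \<longlonglongrightarrow> 0"
    and \<beta>: "0 < \<beta>" "eventually (\<lambda>n. real n powr \<beta> \<le> n * h n ^ CARD('d)) sequentially"
    and j: "j \<in> {1..Q}"
  shows "AE \<omega> in M. (\<lambda>n. expectation (\<lambda>\<xi>. \<bar>nn n (h n) \<omega> (X \<xi>) j - \<eta> j (X \<xi>)\<bar>)) \<longlonglongrightarrow> 0"
proof (rule AE_tendsto_zeroI)
  fix e :: real assume e: "e > 0"
  \<comment> \<open>With wsum errors of 2 \<delta>, \<open>nn_close\<close> yields 4 \<delta> / fmin
    = e/2 at regular points. The bad points and the deviating points each have probability below
    e/4, and the integrand is at most 1 there.\<close>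
  define \<delta> where "\<delta> = e * fmin / 8"
  have \<delta>: "\<delta> > 0" using e fmin_pos by (simp add: \<delta>_def)
  let ?D = "\<lambda>n \<omega>. {\<xi> \<in> space M. X \<xi> \<in> good (h n) \<delta> \<and> deviates n {1..n} (h n) \<delta> (\<lambda>m. Z m \<omega>) (X \<xi>)}"
  let ?B = "\<lambda>n. {\<xi> \<in> space M. X \<xi> \<notin> good (h n) \<delta>}"
  have B: "eventually (\<lambda>n. prob (?B n) < e / 4) sequentially"
    using prob_not_good[OF h \<delta>] e by (intro order_tendstoD(2)) auto
  have "AE \<omega> in M. eventually (\<lambda>n. prob (?D n \<omega>) < e / 4) sequentially"
    using e by (intro new_point_deviates[OF h(1) \<beta> \<delta>]) simp
  then show "AE \<omega> in M. eventually (\<lambda>n. \<bar>expectation (\<lambda>\<xi>. \<bar>nn n (h n) \<omega> (X \<xi>) j - \<eta> j (X \<xi>)\<bar>)\<bar> \<le> e) sequentially"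
  proof (rule AE_mp, intro AE_I2 impI)
    fix \<omega> assume \<omega>: "\<omega> \<in> space M" and D: "eventually (\<lambda>n. prob (?D n \<omega>) < e / 4) sequentially"
    show "eventually (\<lambda>n. \<bar>expectation (\<lambda>\<xi>. \<bar>nn n (h n) \<omega> (X \<xi>) j - \<eta> j (X \<xi>)\<bar>)\<bar> \<le> e) sequentially"
      using h(1) B D eventually_ge_at_top[of 1]
    proof eventually_elim
      case (elim n)
      let ?V = "\<lambda>\<xi>. \<bar>nn n (h n) \<omega> (X \<xi>) j - \<eta> j (X \<xi>)\<bar>"
      note [measurable] = \<eta>_measurable nn_measurable[OF X_measurable measurable_const[OF \<omega>], of n "h n" j]
      have [measurable]: "Measurable.pred M (\<lambda>\<xi>. deviates n {1..n} (h n) \<delta> (\<lambda>m. Z m \<omega>) (X \<xi>))"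
        by (rule deviates_measurable[of _ _ _ "\<lambda>m _. Z m \<omega>"])
           (use measurable_space[OF Z_measurable \<omega>] in \<open>auto intro!: measurable_const\<close>)
      have BD: "?B n \<in> sets M" "?D n \<omega> \<in> sets M" by measurable
      have V1: "?V \<xi> \<le> 1" for \<xi>
        using soft_nn_range[OF elim(1), of "\<lambda>l. Xs l \<omega>" "\<lambda>l. Ys l \<omega>" n "X \<xi>" j] \<eta>_range[of j "X \<xi>"]
        by (simp add: abs_le_iff)
      have "expectation ?V \<le> expectation (\<lambda>\<xi>. e / 2 + indicator (?B n) \<xi> + indicator (?D n \<omega>) \<xi>)"
      proof (rule integral_mono_AE)
        show "integrable M ?V" by (rule integrable_const_bound[of _ 1]) (use V1 in auto)
        show "AE \<xi> in M. ?V \<xi> \<le> e / 2 + indicator (?B n) \<xi> + indicator (?D n \<omega>) \<xi>"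
        proof (rule AE_I2)
          fix \<xi> assume \<xi>: "\<xi> \<in> space M"
          show "?V \<xi> \<le> e / 2 + indicator (?B n) \<xi> + indicator (?D n \<omega>) \<xi>"
          proof (cases "\<xi> \<in> ?B n \<union> ?D n \<omega>")
            case True
            then have "1 \<le> indicator (?B n) \<xi> + (indicator (?D n \<omega>) \<xi> :: real)" by (auto simp: indicator_def)
            then show ?thesis using V1[of \<xi>] e by linarith
          next
            case False
            then have g: "X \<xi> \<in> good (h n) \<delta>" "\<not> deviates n {1..n} (h n) \<delta> (\<lambda>m. Z m \<omega>) (X \<xi>)"
              using \<xi> by auto
            have "?V \<xi> \<le> 2 * (2 * \<delta>) / fmin"
            proof (rule nn_close[OF _ elim(1) elim(4) j])
              fix i assume "i \<le> Q"
              then show "\<bar>wsum (h n) {1..n} (\<lambda>m. Z m \<omega>) i (X \<xi>) - n * joint i (X \<xi>)\<bar> \<le> n * (2 * \<delta>)"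
                using wsum_close_joint[OF g, of i] \<delta> by simp
            qed (use g in \<open>auto simp: good_def\<close>)
            also have "\<dots> = e / 2" using fmin_pos by (simp add: \<delta>_def)
            finally show ?thesis using False by simp
          qed
        qed
        show "integrable M (\<lambda>\<xi>. e / 2 + indicator (?B n) \<xi> + indicator (?D n \<omega>) \<xi>)"
          using BD by (intro Bochner_Integration.integrable_add integrable_const integrable_real_indicator)
            (auto simp: emeasure_eq_measure)
      qed
      also have "\<dots> = e / 2 + prob (?B n) + prob (?D n \<omega>)"
        using BD by (simp add: prob_space emeasure_eq_measure)
      finally show ?case using elim by simp
    qed
  qed
qed

text \<open>As each \<open>\<eta> i\<close> lies in [0,1], every one of the finitely many risk terms
  differs from its limit by at most the L1 error of the assignment probability.\<close>

lemma soft_nn_risk_tendsto: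
  fixes h :: "nat \<Rightarrow> real"
  assumes h: "eventually (\<lambda>n. 0 < h n) sequentially" "h \<longlonglongrightarrow> 0"
    and \<beta>: "0 < \<beta>" "eventually (\<lambda>n. real n powr \<beta> \<le> n * h n ^ CARD('d)) sequentially"
  shows "AE \<omega> in M. (\<lambda>n. soft_nn_risk M X Q \<eta> (\<lambda>l. Xs l \<omega>) (\<lambda>l. Ys l \<omega>) n (h n)) \<longlonglongrightarrow> risk_limit"
proof -
  have "AE \<omega> in M. \<forall>j\<in>{1..Q}. (\<lambda>n. expectation (\<lambda>\<xi>. \<bar>nn n (h n) \<omega> (X \<xi>) j - \<eta> j (X \<xi>)\<bar>)) \<longlonglongrightarrow> 0"
    using nn_L1_tendsto[OF h \<beta>] by (intro AE_finite_allI) auto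
  then show ?thesis
  proof (rule AE_mp, intro AE_I2 impI)
    fix \<omega> assume \<omega>: "\<omega> \<in> space M"
      and lim: "\<forall>j\<in>{1..Q}. (\<lambda>n. expectation (\<lambda>\<xi>. \<bar>nn n (h n) \<omega> (X \<xi>) j - \<eta> j (X \<xi>)\<bar>)) \<longlonglongrightarrow> 0"
    note [measurable] = \<eta>_measurable nn_measurable[OF X_measurable measurable_const[OF \<omega>]]
    have "(\<lambda>n. expectation (\<lambda>\<xi>. \<eta> i (X \<xi>) * nn n (h n) \<omega> (X \<xi>) j)) \<longlonglongrightarrow> expectation (\<lambda>\<xi>. \<eta> i (X \<xi>) * \<eta> j (X \<xi>))"
      if j: "j \<in> {1..Q}" for i j
    proof (rule LIM_zero_cancel, rule Lim_null_comparison[OF _ lim[rule_format, OF j]])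
      show "eventually (\<lambda>n. norm (expectation (\<lambda>\<xi>. \<eta> i (X \<xi>) * nn n (h n) \<omega> (X \<xi>) j) - expectation (\<lambda>\<xi>. \<eta> i (X \<xi>) * \<eta> j (X \<xi>)))
          \<le> expectation (\<lambda>\<xi>. \<bar>nn n (h n) \<omega> (X \<xi>) j - \<eta> j (X \<xi>)\<bar>)) sequentially"
        using h(1)
      proof eventually_elim
        case (elim n)
        have nn: "\<bar>nn n (h n) \<omega> (X \<xi>) j\<bar> \<le> 1" for \<xi>
          using soft_nn_range[OF elim, of "\<lambda>l. Xs l \<omega>" "\<lambda>l. Ys l \<omega>" n "X \<xi>" j] by simp
        have \<eta>: "\<bar>\<eta> i (X \<xi>)\<bar> \<le> 1" for i \<xi> using \<eta>_range[of i "X \<xi>"] by simp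
        have i1: "integrable M (\<lambda>\<xi>. \<eta> i (X \<xi>) * nn n (h n) \<omega> (X \<xi>) j)"
          by (rule integrable_const_bound[of _ 1]) (auto simp: abs_mult intro!: AE_I2 mult_le_one nn \<eta>)
        have i2: "integrable M (\<lambda>\<xi>. \<eta> i (X \<xi>) * \<eta> j (X \<xi>))"
          by (rule integrable_const_bound[of _ 1]) (auto simp: abs_mult intro!: AE_I2 mult_le_one \<eta>)
        have i3: "integrable M (\<lambda>\<xi>. \<bar>nn n (h n) \<omega> (X \<xi>) j - \<eta> j (X \<xi>)\<bar>)"
        proof (rule integrable_const_bound[of _ 2])
          have "norm \<bar>nn n (h n) \<omega> (X \<xi>) j - \<eta> j (X \<xi>)\<bar> \<le> 2" for \<xi>
            using nn[of \<xi>] \<eta>[of j \<xi>] by (simp add: abs_le_iff)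
          then show "AE \<xi> in M. norm \<bar>nn n (h n) \<omega> (X \<xi>) j - \<eta> j (X \<xi>)\<bar> \<le> 2" by simp
        qed measurable
        have "norm (expectation (\<lambda>\<xi>. \<eta> i (X \<xi>) * nn n (h n) \<omega> (X \<xi>) j) - expectation (\<lambda>\<xi>. \<eta> i (X \<xi>) * \<eta> j (X \<xi>))) =
            norm (expectation (\<lambda>\<xi>. \<eta> i (X \<xi>) * nn n (h n) \<omega> (X \<xi>) j - \<eta> i (X \<xi>) * \<eta> j (X \<xi>)))"
          by (simp only: Bochner_Integration.integral_diff[OF i1 i2])
        also have "\<dots> \<le> expectation (\<lambda>\<xi>. \<bar>\<eta> i (X \<xi>) * nn n (h n) \<omega> (X \<xi>) j - \<eta> i (X \<xi>) * \<eta> j (X \<xi>)\<bar>)"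
          using integral_norm_bound[of M "\<lambda>\<xi>. \<eta> i (X \<xi>) * nn n (h n) \<omega> (X \<xi>) j - \<eta> i (X \<xi>) * \<eta> j (X \<xi>)"] by simp
        also have "\<dots> \<le> expectation (\<lambda>\<xi>. \<bar>nn n (h n) \<omega> (X \<xi>) j - \<eta> j (X \<xi>)\<bar>)"
        proof (rule integral_mono)
          show "integrable M (\<lambda>\<xi>. \<bar>\<eta> i (X \<xi>) * nn n (h n) \<omega> (X \<xi>) j - \<eta> i (X \<xi>) * \<eta> j (X \<xi>)\<bar>)"
            using i1 i2 by simp
          show "\<bar>\<eta> i (X \<xi>) * nn n (h n) \<omega> (X \<xi>) j - \<eta> i (X \<xi>) * \<eta> j (X \<xi>)\<bar> \<le> \<bar>nn n (h n) \<omega> (X \<xi>) j - \<eta> j (X \<xi>)\<bar>" for \<xi>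
            unfolding right_diff_distrib[symmetric] abs_mult by (intro mult_left_le_one_le \<eta>) auto
        qed (rule i3)
        finally show ?case .
      qed
    qed
    then show "(\<lambda>n. soft_nn_risk M X Q \<eta> (\<lambda>l. Xs l \<omega>) (\<lambda>l. Ys l \<omega>) n (h n)) \<longlonglongrightarrow> risk_limit"
      unfolding soft_nn_risk_def risk_limit_def by (intro tendsto_sum) auto
  qed
qed

end

section \<open>The resubstitution error\<close>

context labelled_sample
begin

text \<open>Because \<open>l\<close> is outside \<open>I\<close>, the evaluation point is
  independent of the sum: the joint law is a product. Each section with the point held fixed is
  bounded by \<open>prob_deviates\<close>, or is empty if the point is not good, and the bound
  integrates to itself.\<close>

lemma prob_sample_point_deviates:
  assumes h: "0 < h" and \<delta>: "0 < \<delta>" and I: "finite I" "I \<subseteq> {1..}" "card I \<le> n" and l: "l \<ge> 1" "l \<notin> I"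
  shows "prob {\<omega> \<in> space M. Xs l \<omega> \<in> good h \<delta> \<and> deviates n I h \<delta> (\<lambda>m. Z m \<omega>) (Xs l \<omega>)} \<le>
    (Q + 1) * (2 * exp (- (rate \<delta> * (real n * h ^ CARD('d)))))"
proof -
  define r where "r = (Q + 1) * (2 * exp (- (rate \<delta> * (real n * h ^ CARD('d)))))"
  define T where "T = Pi\<^sub>M I (\<lambda>_. E)"
  define W where "W \<omega> = restrict (\<lambda>m. Z m \<omega>) I" for \<omega>
  define U where "U = Pi\<^sub>M {l} (\<lambda>_. E)"
  \<comment> \<open>The single point is also kept as a restricted family, the form in which
    independence of disjoint index blocks is available.\<close>
  define V where "V \<omega> = restrict (\<lambda>m. Z m \<omega>) {l}" for \<omega>
  have iv: "indep_var U V T W"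
    unfolding T_def U_def V_def W_def by (rule indep_var_restrict[OF indep_Z[of "{1..}"]]) (use l I in auto)
  have W[measurable]: "W \<in> measurable M T" and V[measurable]: "V \<in> measurable M U"
    and joint_distr: "distr M U V \<Otimes>\<^sub>M distr M T W = distr M (U \<Otimes>\<^sub>M T) (\<lambda>\<omega>. (V \<omega>, W \<omega>))"
    using iv unfolding indep_var_distribution_eq by auto
  have V_l: "fst (V \<omega> l) = Xs l \<omega>" for \<omega> by (simp add: V_def Z_def)
  have dev_W: "deviates n I h \<delta> (W \<omega>) x = deviates n I h \<delta> (\<lambda>m. Z m \<omega>) x" for \<omega> x
    by (simp add: deviates_def wsum_def W_def)
  interpret W: prob_space "distr M T W" by (rule prob_space_distr) simp
  interpret V: prob_space "distr M U V" by (rule prob_space_distr) simp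
  define S where "S = {p \<in> space (U \<Otimes>\<^sub>M T). fst (fst p l) \<in> good h \<delta> \<and> deviates n I h \<delta> (snd p) (fst (fst p l))}"
  have S: "S \<in> sets (U \<Otimes>\<^sub>M T)"
  proof -
    have x[measurable]: "(\<lambda>p. fst (fst p l)) \<in> borel_measurable (U \<Otimes>\<^sub>M T)"
      unfolding U_def by measurable
    have [measurable]: "Measurable.pred (U \<Otimes>\<^sub>M T) (\<lambda>p. deviates n I h \<delta> (\<lambda>m. snd p m) (fst (fst p l)))"
      by (rule deviates_measurable[OF x])
        (auto simp: T_def intro!: measurable_compose[OF measurable_snd measurable_component_singleton])
    show ?thesis unfolding S_def by measurable
  qed
  have bound: "emeasure (distr M T W) (Pair v -` S) \<le> ennreal r" if v: "v \<in> space U" for v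
  proof -
    have e: "W -` (Pair v -` S) \<inter> space M =
        (if fst (v l) \<in> good h \<delta> then {\<omega> \<in> space M. deviates n I h \<delta> (\<lambda>m. Z m \<omega>) (fst (v l))} else {})"
      using measurable_space[OF W] v by (auto simp: S_def space_pair_measure dev_W)
    have "emeasure (distr M T W) (Pair v -` S) = emeasure M (W -` (Pair v -` S) \<inter> space M)"
      using sets_Pair1[OF S] by (intro emeasure_distr W) auto
    also have "\<dots> \<le> ennreal r"
      unfolding e using prob_deviates[OF _ h \<delta> I, of "fst (v l)"]
      by (auto simp: r_def emeasure_eq_measure intro!: ennreal_leI)
    finally show ?thesis .
  qed
  have e: "{\<omega> \<in> space M. Xs l \<omega> \<in> good h \<delta> \<and> deviates n I h \<delta> (\<lambda>m. Z m \<omega>) (Xs l \<omega>)} =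
      (\<lambda>\<omega>. (V \<omega>, W \<omega>)) -` S \<inter> space M"
    using measurable_space[OF W] measurable_space[OF V] by (auto simp: S_def space_pair_measure dev_W V_l)
  have "emeasure M ((\<lambda>\<omega>. (V \<omega>, W \<omega>)) -` S \<inter> space M) = emeasure (distr M U V \<Otimes>\<^sub>M distr M T W) S"
    unfolding joint_distr by (rule emeasure_distr[symmetric]) (use S in auto)
  also have "\<dots> = (\<integral>\<^sup>+v. emeasure (distr M T W) (Pair v -` S) \<partial>distr M U V)"
    using S by (intro W.emeasure_pair_measure_alt) (simp cong: sets_pair_measure_cong)
  also have "\<dots> \<le> (\<integral>\<^sup>+v. ennreal r \<partial>distr M U V)"
    by (intro nn_integral_mono bound) simp
  also have "\<dots> = ennreal r" using V.emeasure_space_1 by simp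
  finally show ?thesis unfolding e by (simp add: emeasure_eq_measure r_def)
qed

text \<open>The index set omits \<open>l\<close> so that the independence bound applies; the union
  over the n points costs a factor n, which the exponential absorbs.\<close>

lemma sample_points_deviate:
  fixes h :: "nat \<Rightarrow> real"
  assumes h: "eventually (\<lambda>n. 0 < h n) sequentially"
    and \<beta>: "0 < \<beta>" "eventually (\<lambda>n. real n powr \<beta> \<le> n * h n ^ CARD('d)) sequentially"
    and \<delta>: "0 < \<delta>"
  shows "AE \<omega> in M. eventually (\<lambda>n. \<forall>l\<in>{1..n}. Xs l \<omega> \<in> good (h n) \<delta> \<longrightarrow>
    \<not> deviates n ({1..n} - {l}) (h n) \<delta> (\<lambda>m. Z m \<omega>) (Xs l \<omega>)) sequentially"
proof -
  let ?P = "\<lambda>n l \<omega>. Xs l \<omega> \<in> good (h n) \<delta> \<and> deviates n ({1..n} - {l}) (h n) \<delta> (\<lambda>m. Z m \<omega>) (Xs l \<omega>)"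
  have P: "{\<omega> \<in> space M. ?P n l \<omega>} \<in> sets M" if "l \<in> {1..n}" for n l
  proof -
    have [measurable]: "Xs l \<in> borel_measurable M" using that by (intro Xs_Ys_measurable) auto
    have [measurable]: "Measurable.pred M (\<lambda>\<omega>. deviates n ({1..n} - {l}) (h n) \<delta> (\<lambda>m. Z m \<omega>) (Xs l \<omega>))"
      by (rule deviates_measurable) auto
    show ?thesis by measurable
  qed
  have "AE \<omega> in M. eventually (\<lambda>n. \<not> (\<exists>l\<in>{1..n}. ?P n l \<omega>)) sequentially"
  proof (rule AE_eventually_not_if_summable)
    have un: "{\<omega> \<in> space M. \<exists>l\<in>{1..n}. ?P n l \<omega>} = (\<Union>l\<in>{1..n}. {\<omega> \<in> space M. ?P n l \<omega>})" for n
      by blast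
    show "{\<omega> \<in> space M. \<exists>l\<in>{1..n}. ?P n l \<omega>} \<in> sets M" for n
      unfolding un using P by (intro sets.finite_UN) auto
    show "summable (\<lambda>n. 2 * (Q + 1) * (real n * exp (- (rate \<delta> * real n powr \<beta>))))"
      by (intro summable_mult summable_exp_minus_powr rate_pos \<delta> \<beta>)
    show "eventually (\<lambda>n. prob {\<omega> \<in> space M. \<exists>l\<in>{1..n}. ?P n l \<omega>} \<le>
        2 * (Q + 1) * (real n * exp (- (rate \<delta> * real n powr \<beta>)))) sequentially"
      using h \<beta>(2)
    proof eventually_elim
      case (elim n)
      have "prob {\<omega> \<in> space M. \<exists>l\<in>{1..n}. ?P n l \<omega>} \<le> (\<Sum>l\<in>{1..n}. prob {\<omega> \<in> space M. ?P n l \<omega>})"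
        unfolding un by (rule measure_UNION_le) (simp, rule P)
      also have "\<dots> \<le> (\<Sum>l\<in>{1..n}. (Q + 1) * (2 * exp (- (rate \<delta> * (real n * h n ^ CARD('d))))))"
      proof (rule sum_mono)
        fix l assume "l \<in> {1..n}"
        moreover have "card ({1..n} - {l}) \<le> n" by (rule order.trans[OF card_Diff1_le]) simp
        ultimately show "prob {\<omega> \<in> space M. ?P n l \<omega>} \<le> (Q + 1) * (2 * exp (- (rate \<delta> * (real n * h n ^ CARD('d)))))"
          by (intro prob_sample_point_deviates elim \<delta>) auto
      qed
      also have "\<dots> = 2 * (Q + 1) * (real n * exp (- (rate \<delta> * (real n * h n ^ CARD('d)))))" by simp
      also have "\<dots> \<le> 2 * (Q + 1) * (real n * exp (- (rate \<delta> * real n powr \<beta>)))"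
        using elim rate_pos[OF \<delta>] by (intro mult_left_mono) auto
      finally show ?case .
    qed
  qed
  then show ?thesis by eventually_elim (auto elim!: eventually_mono)
qed

text \<open>Putting the point back adds its own kernel value, at most n \<delta>, and raises the
  count from n - 1 to n, which moves the target by at most \<open>fmax\<close> and so by at most n
  \<delta>. Together with the 2 \<delta> of \<open>wsum_close_joint\<close> this fits into 4
  \<delta>.\<close>

lemma wsum_self_close:
  assumes x: "x = Xs l \<omega>" "x \<in> good h \<delta>" and h: "0 < h" and \<delta>: "0 < \<delta>" and l: "l \<in> {1..n}"
    and dev: "\<not> deviates n ({1..n} - {l}) h \<delta> (\<lambda>m. Z m \<omega>) x" and j: "j \<le> Q"
    and n: "fmax \<le> n * \<delta>" "kernel_max TYPE('d) / h ^ CARD('d) \<le> n * \<delta>"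
  shows "\<bar>wsum h {1..n} (\<lambda>m. Z m \<omega>) j x - n * joint j x\<bar> \<le> n * (4 * \<delta>)"
proof -
  let ?I = "{1..n} - {l}"
  define w where "w = scaled_kernel h (x - fst (Z l \<omega>)) * of_bool (snd (Z l \<omega>) \<in> cls j)"
  have "wsum h {1..n} (\<lambda>m. Z m \<omega>) j x = w + wsum h ?I (\<lambda>m. Z m \<omega>) j x"
    unfolding wsum_def w_def using l by (subst sum.remove[of _ l]) auto
  moreover have "real n = real (card ?I) + 1" using l by simp
  moreover have "\<bar>wsum h ?I (\<lambda>m. Z m \<omega>) j x - card ?I * joint j x\<bar> \<le> n * (2 * \<delta>)"
    using l by (intro wsum_close_joint[OF x(2) dev j _ \<delta>]) auto
  moreover have "0 \<le> w" "w \<le> n * \<delta>"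
  proof -
    have "w \<le> scaled_kernel h (x - fst (Z l \<omega>))" "0 \<le> w"
      using scaled_kernel_pos[OF h, of "x - fst (Z l \<omega>)"] by (auto simp: w_def)
    then show "0 \<le> w" "w \<le> n * \<delta>" using scaled_kernel_le[OF h, of "x - fst (Z l \<omega>)"] n by linarith+
  qed
  moreover have "0 \<le> joint j x" "joint j x \<le> n * \<delta>"
  proof -
    have "joint j x \<le> f x" by (simp add: mult_left_le_one_le post_range f_nonneg)
    then show "joint j x \<le> n * \<delta>" using x(2) n by (auto simp: good_def)
    show "0 \<le> joint j x" by (simp add: post_range f_nonneg)
  qed
  ultimately show ?thesis by (simp add: abs_le_iff distrib_right)
qed

text \<open>Splitting by the value i of \<open>Y\<close> and conditioning on \<open>X\<close> turns
  each label indicator into \<open>\<eta> i\<close>, with the posterior \<open>\<eta> j\<close> as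
  test function.\<close>

lemma expectation_labels_differ:
  "expectation (\<lambda>\<omega>. \<Sum>j\<in>{1..Q}. of_bool (Y \<omega> \<noteq> j) * \<eta> j (X \<omega>)) = risk_limit"
proof -
  note [measurable] = \<eta>_measurable
  have int: "integrable M (\<lambda>\<omega>. \<eta> j (X \<omega>) * of_bool (Y \<omega> = i))" for i j
    by (rule integrable_const_bound[of _ 1]) (use \<eta>_range in auto)
  have "expectation (\<lambda>\<omega>. \<Sum>j\<in>{1..Q}. of_bool (Y \<omega> \<noteq> j) * \<eta> j (X \<omega>)) =
      expectation (\<lambda>\<omega>. \<Sum>i\<in>{1..Q}. \<Sum>j\<in>{1..Q} - {i}. \<eta> j (X \<omega>) * of_bool (Y \<omega> = i))"
  proof (rule integral_cong_AE)
    show "AE \<omega> in M. (\<Sum>j\<in>{1..Q}. of_bool (Y \<omega> \<noteq> j) * \<eta> j (X \<omega>)) =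
        (\<Sum>i\<in>{1..Q}. \<Sum>j\<in>{1..Q} - {i}. \<eta> j (X \<omega>) * of_bool (Y \<omega> = i))"
      using label_range
    proof eventually_elim
      case (elim \<omega>)
      have "(\<Sum>i\<in>{1..Q}. \<Sum>j\<in>{1..Q} - {i}. \<eta> j (X \<omega>) * of_bool (Y \<omega> = i)) =
          (\<Sum>i\<in>{1..Q}. if i = Y \<omega> then \<Sum>j\<in>{1..Q} - {Y \<omega>}. \<eta> j (X \<omega>) else 0)"
        by (intro sum.cong) auto
      also have "\<dots> = (\<Sum>j\<in>{1..Q} - {Y \<omega>}. \<eta> j (X \<omega>))" using elim by simp
      also have "\<dots> = (\<Sum>j\<in>{1..Q}. of_bool (Y \<omega> \<noteq> j) * \<eta> j (X \<omega>))"
        by (rule sum.mono_neutral_cong_left) auto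
      finally show ?case by simp
    qed
  qed measurable
  also have "\<dots> = (\<Sum>i\<in>{1..Q}. \<Sum>j\<in>{1..Q} - {i}. expectation (\<lambda>\<omega>. \<eta> j (X \<omega>) * of_bool (Y \<omega> = i)))"
    using int by (subst Bochner_Integration.integral_sum, (intro Bochner_Integration.integrable_sum, simp),
        intro sum.cong refl Bochner_Integration.integral_sum) simp
  also have "\<dots> = risk_limit"
    unfolding risk_limit_def
  proof (intro sum.cong refl)
    fix i j assume "i \<in> {1..Q}"
    then have "expectation (\<lambda>\<omega>. \<eta> j (X \<omega>) * of_bool (Y \<omega> = i)) = expectation (\<lambda>\<omega>. \<eta> j (X \<omega>) * \<eta> i (X \<omega>))"
      using \<eta>_range by (intro \<eta>_posterior[of _ _ 1]) auto
    then show "expectation (\<lambda>\<omega>. \<eta> j (X \<omega>) * of_bool (Y \<omega> = i)) = expectation (\<lambda>\<omega>. \<eta> i (X \<omega>) * \<eta> j (X \<omega>))"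
      by (simp add: mult.commute)
  qed
  finally show ?thesis .
qed

text \<open>At the training points the rule is first replaced by the true posteriors, and the
  resulting average then obeys the law of large numbers. Only training points outside the good set
  spoil the replacement, and their fraction tends to 0.\<close>

lemma resubstitution_tendsto:
  fixes h :: "nat \<Rightarrow> real"
  assumes h: "eventually (\<lambda>n. 0 < h n) sequentially" "h \<longlonglongrightarrow> 0"
    and \<beta>: "0 < \<beta>" "eventually (\<lambda>n. real n powr \<beta> \<le> n * h n ^ CARD('d)) sequentially"
  shows "AE \<omega> in M. (\<lambda>n. (\<Sum>l=1..n. \<Sum>j\<in>{1..Q}. of_bool (Ys l \<omega> \<noteq> j) * nn n (h n) \<omega> (Xs l \<omega>) j) / n)
    \<longlonglongrightarrow> risk_limit"
proof -
  note [measurable] = \<eta>_measurable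
  \<comment> \<open>The error at a labelled point of the randomised rule that assigns classes with
    the true posterior probabilities.\<close>
  define q where "q z = (\<Sum>j\<in>{1..Q}. of_bool (snd z \<noteq> j) * \<eta> j (fst z))" for z
  have q_measurable[measurable]: "q \<in> borel_measurable E" unfolding q_def[abs_def] by measurable
  have q_range: "0 \<le> q z \<and> q z \<le> Q + 1" for z
  proof
    show "0 \<le> q z" using \<eta>_range by (auto simp: q_def intro!: sum_nonneg)
    have "q z \<le> (\<Sum>j\<in>{1..Q}. 1)" unfolding q_def by (intro sum_mono) (use \<eta>_range in auto)
    then show "q z \<le> Q + 1" by simp
  qed
  let ?R = "\<lambda>n \<omega>. (\<Sum>l=1..n. \<Sum>j\<in>{1..Q}. of_bool (Ys l \<omega> \<noteq> j) * nn n (h n) \<omega> (Xs l \<omega>) j) / n"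
  have mean: "AE \<omega> in M. (\<lambda>n. (\<Sum>l=1..n. q (Z l \<omega>)) / n - risk_limit) \<longlonglongrightarrow> 0"
    using sample_mean_tendsto[of "\<lambda>_. q" "Q + 1"] q_range expectation_labels_differ by (simp add: q_def)
  have nlim: "filterlim (\<lambda>n. real n * h n ^ CARD('d)) at_top sequentially"
  proof (rule filterlim_at_top_mono[OF _ \<beta>(2)])
    show "filterlim (\<lambda>n. real n powr \<beta>) at_top sequentially" using \<beta>(1) by real_asymp
  qed
  have diff: "AE \<omega> in M. (\<lambda>n. ?R n \<omega> - (\<Sum>l=1..n. q (Z l \<omega>)) / n) \<longlonglongrightarrow> 0"
  proof (rule AE_tendsto_zeroI)
    fix e :: real assume e: "e > 0"
    \<comment> \<open>Chosen so that 8 \<delta> / fmin = e / (2 (Q + 1)): summed over the Q classes,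
      good points contribute at most e/2. With \<open>e'\<close> below, bad points contribute at
      most e/4. Adding 1 to Q avoids a zero denominator.\<close>
    define \<delta> where "\<delta> = e * fmin / (16 * (real Q + 1))"
    have \<delta>: "\<delta> > 0" using e fmin_pos by (simp add: \<delta>_def add_nonneg_pos)
    define e' where "e' = e / (4 * (real Q + 1))"
    have e': "e' > 0" using e by (simp add: e'_def add_nonneg_pos)
    define \<phi> where "\<phi> n z = (indicator (- good (h n) \<delta>) (fst z) :: real)" for n and z :: "(real ^ 'd) \<times> nat"
    have [measurable]: "\<phi> n \<in> borel_measurable E" for n unfolding \<phi>_def by measurable
    have E\<phi>: "expectation (\<lambda>\<omega>. \<phi> n (X \<omega>, Y \<omega>)) = prob {\<omega> \<in> space M. X \<omega> \<notin> good (h n) \<delta>}" for n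
    proof -
      have "expectation (\<lambda>\<omega>. \<phi> n (X \<omega>, Y \<omega>)) = expectation (indicator {\<omega> \<in> space M. X \<omega> \<notin> good (h n) \<delta>})"
        by (intro Bochner_Integration.integral_cong) (auto simp: \<phi>_def indicator_def)
      then show ?thesis by simp
    qed
    have "AE \<omega> in M. (\<lambda>n. (\<Sum>l=1..n. \<phi> n (Z l \<omega>)) / n - prob {\<omega> \<in> space M. X \<omega> \<notin> good (h n) \<delta>}) \<longlonglongrightarrow> 0"
      using sample_mean_tendsto[of \<phi> 1] by (simp add: E\<phi>) (simp add: \<phi>_def indicator_def)
    then show "AE \<omega> in M. eventually (\<lambda>n. \<bar>?R n \<omega> - (\<Sum>l=1..n. q (Z l \<omega>)) / n\<bar> \<le> e) sequentially"
      using sample_points_deviate[OF h(1) \<beta> \<delta>]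
    proof eventually_elim
      case (elim \<omega>)
      have "(\<lambda>n. (\<Sum>l=1..n. \<phi> n (Z l \<omega>)) / n) \<longlonglongrightarrow> 0 + 0"
        using tendsto_add[OF elim(1) prob_not_good[OF h \<delta>]] by simp
      then have bad: "eventually (\<lambda>n. (\<Sum>l=1..n. \<phi> n (Z l \<omega>)) / n < e') sequentially"
        using e' by (intro order_tendstoD(2)) auto
      \<comment> \<open>These make a point's own kernel value and the change of the count
        negligible, as \<open>wsum_self_close\<close> demands.\<close>
      have big: "eventually (\<lambda>n. kernel_max TYPE('d) / \<delta> \<le> real n * h n ^ CARD('d)) sequentially"
        "eventually (\<lambda>n. fmax / \<delta> \<le> real n) sequentially"
        using nlim filterlim_real_sequentially by (auto simp: filterlim_at_top)
      show ?case using h(1) bad big elim(2) eventually_ge_at_top[of 1]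
      proof eventually_elim
        case (elim n)
        have n: "fmax \<le> n * \<delta>" "kernel_max TYPE('d) / h n ^ CARD('d) \<le> n * \<delta>"
          using elim(1,3,4) \<delta> by (auto simp: field_simps)
        have near: "\<bar>nn n (h n) \<omega> (Xs l \<omega>) j - \<eta> j (Xs l \<omega>)\<bar> \<le> 8 * \<delta> / fmin + \<phi> n (Z l \<omega>)"
          if l: "l \<in> {1..n}" and j: "j \<in> {1..Q}" for l j
        proof (cases "Xs l \<omega> \<in> good (h n) \<delta>")
          case True
          then have "\<not> deviates n ({1..n} - {l}) (h n) \<delta> (\<lambda>m. Z m \<omega>) (Xs l \<omega>)" using elim(5) l by blast
          then have "\<bar>nn n (h n) \<omega> (Xs l \<omega>) j - \<eta> j (Xs l \<omega>)\<bar> \<le> 2 * (4 * \<delta>) / fmin"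
            using wsum_self_close[OF refl True elim(1) \<delta> l _ _ n] True elim(6)
            by (intro nn_close[OF _ elim(1) _ j]) (auto simp: good_def)
          then show ?thesis using True by (simp add: \<phi>_def Z_def)
        next
          case False
          have "\<bar>nn n (h n) \<omega> (Xs l \<omega>) j - \<eta> j (Xs l \<omega>)\<bar> \<le> 1"
            using soft_nn_range[OF elim(1), of "\<lambda>l. Xs l \<omega>" "\<lambda>l. Ys l \<omega>" n "Xs l \<omega>" j] \<eta>_range[of j "Xs l \<omega>"]
            by (simp add: abs_le_iff)
          then show ?thesis using False \<delta> fmin_pos by (simp add: \<phi>_def Z_def add_increasing)
        qed
        have "(\<Sum>l=1..n. \<Sum>j\<in>{1..Q}. of_bool (Ys l \<omega> \<noteq> j) * nn n (h n) \<omega> (Xs l \<omega>) j) - (\<Sum>l=1..n. q (Z l \<omega>)) =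
            (\<Sum>l=1..n. \<Sum>j\<in>{1..Q}. of_bool (Ys l \<omega> \<noteq> j) * (nn n (h n) \<omega> (Xs l \<omega>) j - \<eta> j (Xs l \<omega>)))"
          by (simp only: q_def Z_def fst_conv snd_conv sum_subtractf[symmetric] right_diff_distrib)
        also have "\<bar>\<dots>\<bar> \<le> (\<Sum>l=1..n. \<Sum>j\<in>{1..Q}. 8 * \<delta> / fmin + \<phi> n (Z l \<omega>))"
        proof (intro order.trans[OF sum_abs] sum_mono)
          fix l j assume "l \<in> {1..n}" "j \<in> {1..Q}"
          note t = near[OF this]
          then show "\<bar>of_bool (Ys l \<omega> \<noteq> j) * (nn n (h n) \<omega> (Xs l \<omega>) j - \<eta> j (Xs l \<omega>))\<bar> \<le> 8 * \<delta> / fmin + \<phi> n (Z l \<omega>)"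
            by (cases "Ys l \<omega> = j") (auto intro: order.trans[OF abs_ge_zero])
        qed
        also have "\<dots> = n * (Q * (8 * \<delta> / fmin)) + Q * (\<Sum>l=1..n. \<phi> n (Z l \<omega>))"
          by (simp add: sum.distrib sum_distrib_left distrib_left)
        also have "\<dots> \<le> n * (e / 2) + n * (e / 2)"
        proof (rule add_mono)
          have "8 * \<delta> / fmin = e / (2 * (real Q + 1))" using fmin_pos by (simp add: \<delta>_def divide_simps)
          then have "Q * (8 * \<delta> / fmin) = e / 2 * (Q / (real Q + 1))" by (simp add: mult.commute)
          also have "\<dots> \<le> e / 2 * 1" using e by (intro mult_left_mono) auto
          finally show "n * (Q * (8 * \<delta> / fmin)) \<le> n * (e / 2)" by (intro mult_left_mono) auto
          have "(\<Sum>l=1..n. \<phi> n (Z l \<omega>)) \<le> n * e'" using elim(2,6) by (simp add: field_simps)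
          then have "Q * (\<Sum>l=1..n. \<phi> n (Z l \<omega>)) \<le> Q * (n * e')" by (intro mult_left_mono) auto
          also have "\<dots> = n * (Q * e')" by simp
          also have "Q * e' = e / 4 * (Q / (real Q + 1))" by (simp add: e'_def)
          also have "n * \<dots> \<le> n * (e / 4 * 1)" using e by (intro mult_left_mono) auto
          also have "\<dots> \<le> n * (e / 2)" using e by (intro mult_left_mono) auto
          finally show "Q * (\<Sum>l=1..n. \<phi> n (Z l \<omega>)) \<le> n * (e / 2)" .
        qed
        finally have "\<bar>(\<Sum>l=1..n. \<Sum>j\<in>{1..Q}. of_bool (Ys l \<omega> \<noteq> j) * nn n (h n) \<omega> (Xs l \<omega>) j) - (\<Sum>l=1..n. q (Z l \<omega>))\<bar> \<le> n * e"
          by (simp only: distrib_left[symmetric] field_sum_of_halves)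
        then show ?case using elim(6)
          by (simp only: diff_divide_distrib[symmetric] abs_divide) (simp add: divide_le_eq mult.commute)
      qed
    qed
  qed
  from diff mean show ?thesis
  proof eventually_elim
    case (elim \<omega>)
    have "(\<lambda>n. ?R n \<omega> - risk_limit) \<longlonglongrightarrow> 0"
      using tendsto_add[OF elim] by simp
    then show ?case by (rule LIM_zero_cancel)
  qed
qed

lemma pair_sum_tendsto:
  fixes h :: "nat \<Rightarrow> real"
  assumes h: "eventually (\<lambda>n. 0 < h n) sequentially" "h \<longlonglongrightarrow> 0"
    and \<beta>: "0 < \<beta>" "eventually (\<lambda>n. real n powr \<beta> \<le> n * h n ^ CARD('d)) sequentially"
  shows "AE \<omega> in M. (\<lambda>n. (1 / (real n)\<^sup>2) *
      (\<Sum>l=1..n. \<Sum>m=l+1..n. theta (\<lambda>l. Ys l \<omega>) l m * pair_weight (\<lambda>l. Xs l \<omega>) n (h n) l m))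
    \<longlonglongrightarrow> risk_limit"
proof -
  \<comment> \<open>The range of the labels is assumed for \<open>Y\<close>; equality in law carries
    it to each \<open>Ys l\<close>, and there are countably many.\<close>
  have "AE \<omega> in M. \<forall>l\<in>{1..}. Ys l \<omega> \<in> {1..Q}"
  proof (subst AE_ball_countable, simp, intro ballI)
    fix l :: nat assume "l \<in> {1..}"
    then have l: "l \<ge> 1" by simp
    have "AE z in distr M E (\<lambda>\<omega>. (X \<omega>, Y \<omega>)). snd z \<in> {1..Q}"
      using label_range by (subst AE_distr_iff) auto
    then have "AE z in distr M E (Z l). snd z \<in> {1..Q}" by (simp only: distr_Z[OF l])
    then show "AE \<omega> in M. Ys l \<omega> \<in> {1..Q}"
      using Z_measurable[OF l] by (subst (asm) AE_distr_iff) (auto simp: Z_def)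
  qed
  then show ?thesis using resubstitution_tendsto[OF h \<beta>]
  proof eventually_elim
    case (elim \<omega>)
    have "eventually (\<lambda>n. (\<Sum>l=1..n. \<Sum>j\<in>{1..Q}. of_bool (Ys l \<omega> \<noteq> j) * nn n (h n) \<omega> (Xs l \<omega>) j) / n =
        (1 / (real n)\<^sup>2) *
      (\<Sum>l=1..n. \<Sum>m=l+1..n. theta (\<lambda>l. Ys l \<omega>) l m * pair_weight (\<lambda>l. Xs l \<omega>) n (h n) l m)) sequentially"
      using h(1) by eventually_elim (use elim(1) in \<open>intro pair_sum_eq_resubstitution[symmetric]; auto\<close>)
    then show ?case using elim(2) by (rule Lim_transform_eventually[rotated])
  qed
qed

end

section \<open>Bandwidths and posterior probabilities\<close>

text \<open>Once h < 1/e, - ln h exceeds 1, so the second limit in (B) forces n h^(d + 2 \<gamma>) >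
  1. Raising to the power d / (d + 2 \<gamma>) gives the exponent 1 - d / (d + 2 \<gamma>).\<close>

lemma bandwidth_condition_lower_bound:
  fixes h :: "nat \<Rightarrow> real"
  assumes B: "bandwidth_condition d \<gamma> h" and \<gamma>: "0 < \<gamma>" and d: "0 < d"
  shows "eventually (\<lambda>n. real n powr (2 * \<gamma> / (d + 2 * \<gamma>)) \<le> n * h n ^ d) sequentially"
proof -
  let ?p = "real d + 2 * \<gamma>"
  have p: "?p > 0" using \<gamma> by (simp add: add_nonneg_pos)
  have pos: "0 < h n" if "n \<ge> 1" for n using B that by (auto simp: bandwidth_condition_def)
  have lim: "h \<longlonglongrightarrow> 0" "(\<lambda>n. - ln (h n) / (real n * h n powr ?p)) \<longlonglongrightarrow> 0"
    using B by (auto simp: bandwidth_condition_def)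
  have "eventually (\<lambda>n. h n < exp (- 1)) sequentially"
    using lim(1) by (rule order_tendstoD) simp
  moreover have "eventually (\<lambda>n. - ln (h n) / (real n * h n powr ?p) < 1) sequentially"
    using lim(2) by (rule order_tendstoD) simp
  ultimately show ?thesis using eventually_ge_at_top[of 1]
  proof eventually_elim
    case (elim n)
    have n: "real n > 0" and hn: "h n > 0" using elim(3) pos by auto
    have "ln (h n) < - 1" using elim(1) hn ln_less_cancel_iff[of "h n" "exp (- 1)"] by simp
    moreover have "- ln (h n) < real n * h n powr ?p"
      using elim(2) pos_divide_less_eq[of "real n * h n powr ?p" "- ln (h n)" 1] n hn by simp
    ultimately have "1 / real n \<le> h n powr ?p" using n by (simp add: field_simps)
    then have "(1 / real n) powr (d / ?p) \<le> (h n powr ?p) powr (d / ?p)"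
      using p n by (intro powr_mono2) auto
    also have "\<dots> = h n ^ d" using p hn by (simp add: powr_powr powr_realpow)
    finally have "real n * (1 / real n) powr (d / ?p) \<le> n * h n ^ d" using n by simp
    also have "real n * (1 / real n) powr (d / ?p) = real n powr (1 - d / ?p)"
      using n by (simp add: powr_diff powr_divide)
    also have "1 - d / ?p = 2 * \<gamma> / ?p" using p by (simp add: field_simps)
    finally show ?case .
  qed
qed

lemma powr_bandwidth_lower_bound:
  fixes hs :: "nat \<Rightarrow> real"
  assumes hs: "\<forall>n\<ge>1. real n powr (- d0) \<le> hs n"
  shows "eventually (\<lambda>n. real n powr (1 - d0 * d) \<le> n * hs n ^ d) sequentially"
  using eventually_ge_at_top[of 1]
proof eventually_elim
  case (elim n)
  have n: "real n > 0" using elim by simp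
  have "real n powr (1 - d0 * d) = real n * (real n powr (- d0)) ^ d"
    using n by (simp add: powr_diff powr_powr[symmetric] powr_realpow powr_minus_divide power_divide powr_power)
  also have "\<dots> \<le> n * hs n ^ d"
    using hs elim by (intro mult_left_mono power_mono) auto
  finally show ?case .
qed

text \<open>A function of \<open>X\<close> is measurable for the sigma-algebra generated by
  \<open>X\<close>, so it can be moved inside the conditional expectation of the class indicator.
  This produces the tested form of the posterior used in \<open>labelled_sample\<close>.\<close>

lemma (in prob_space)
  assumes X[measurable]: "X \<in> borel_measurable M" and Y[measurable]: "Y \<in> measurable M (count_space UNIV)"
    and g: "class_posterior_of M X Y i g"
  shows class_posterior_range: "AE \<omega> in M. 0 \<le> g (X \<omega>) \<and> g (X \<omega>) \<le> 1"
    and class_posterior_expectation: "k \<in> borel_measurable borel \<Longrightarrow> (\<And>x. \<bar>k x\<bar> \<le> b) \<Longrightarrow>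
      expectation (\<lambda>\<omega>. k (X \<omega>) * of_bool (Y \<omega> = i)) = expectation (\<lambda>\<omega>. k (X \<omega>) * g (X \<omega>))"
proof -
  define F where "F = vimage_algebra (space M) X borel"
  define A where "A = {\<omega> \<in> space M. Y \<omega> = i}"
  have A[measurable]: "A \<in> sets M" unfolding A_def by measurable
  have XF: "X \<in> measurable F borel" unfolding F_def by (rule measurable_vimage_algebra1) simp
  have "subalgebra M F"
    using X by (auto simp: subalgebra_def F_def measurable_iff_sets)
  then interpret finite_measure_subalgebra M F by unfold_locales
  have [measurable]: "g \<in> borel_measurable borel"
    and gA: "AE \<omega> in M. g (X \<omega>) = real_cond_exp M F (indicator A) \<omega>"
    using g by (auto simp: class_posterior_of_def F_def A_def)
  have iA: "integrable M (indicator A :: 'a \<Rightarrow> real)" by (simp add: integrable_indicator_iff emeasure_eq_measure)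
  have "AE \<omega> in M. 0 \<le> real_cond_exp M F (indicator A) \<omega>"
    by (rule real_cond_exp_ge_c[OF iA]) simp
  moreover have "AE \<omega> in M. real_cond_exp M F (indicator A) \<omega> \<le> 1"
    by (rule real_cond_exp_le_c[OF iA]) (auto simp: indicator_def)
  ultimately show "AE \<omega> in M. 0 \<le> g (X \<omega>) \<and> g (X \<omega>) \<le> 1"
    using gA by eventually_elim simp
  show "expectation (\<lambda>\<omega>. k (X \<omega>) * of_bool (Y \<omega> = i)) = expectation (\<lambda>\<omega>. k (X \<omega>) * g (X \<omega>))"
    if [measurable]: "k \<in> borel_measurable borel" and b: "\<And>x. \<bar>k x\<bar> \<le> b"
  proof -
    have kF: "(\<lambda>\<omega>. k (X \<omega>)) \<in> borel_measurable F" by (rule measurable_compose[OF XF]) simp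
    have i: "integrable M (\<lambda>\<omega>. k (X \<omega>) * indicator A \<omega>)"
      by (rule integrable_const_bound[of _ b])
         (use b order.trans[OF abs_ge_zero b] in \<open>auto simp: indicator_def\<close>)
    have "expectation (\<lambda>\<omega>. k (X \<omega>) * of_bool (Y \<omega> = i)) = expectation (\<lambda>\<omega>. k (X \<omega>) * indicator A \<omega>)"
      by (intro Bochner_Integration.integral_cong) (auto simp: A_def indicator_def)
    also have "\<dots> = expectation (\<lambda>\<omega>. k (X \<omega>) * real_cond_exp M F (indicator A) \<omega>)"
      by (rule real_cond_exp_intg(2)[OF i kF, symmetric]) simp
    also have "\<dots> = expectation (\<lambda>\<omega>. k (X \<omega>) * g (X \<omega>))"
      by (rule integral_cong_AE) (use gA in \<open>auto elim!: eventually_mono\<close>)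
    finally show ?thesis .
  qed
qed

theorem theorem2:
  fixes M :: "'a measure"
    and X :: "'a \<Rightarrow> real ^ 'd" and Y :: "'a \<Rightarrow> nat"
    and Xs :: "nat \<Rightarrow> 'a \<Rightarrow> real ^ 'd" and Ys :: "nat \<Rightarrow> 'a \<Rightarrow> nat"
    and S :: "(real ^ 'd) set" and M0 :: real and Q :: nat
    and f :: "real ^ 'd \<Rightarrow> real" and fc \<eta> :: "nat \<Rightarrow> real ^ 'd \<Rightarrow> real"
    and fmin fmax :: real and fcmin fcmax c :: "nat \<Rightarrow> real" and \<gamma> d0 :: real
    and h hs :: "nat \<Rightarrow> real"
  assumes "prob_space M"
    and "X \<in> borel_measurable M" and "Y \<in> measurable M (count_space UNIV)"
    and "S \<subseteq> cbox (\<chi> k. - M0) (\<chi> k. M0)"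
    and "AE \<omega> in M. X \<omega> \<in> S" and "AE \<omega> in M. Y \<omega> \<in> {1..Q}"
    and iid_indep: "prob_space.indep_vars M (\<lambda>_. borel \<Otimes>\<^sub>M count_space UNIV)
                      (\<lambda>l \<omega>. (Xs l \<omega>, Ys l \<omega>)) {1..}"
    and iid_copies: "\<forall>l\<ge>1. distr M (borel \<Otimes>\<^sub>M count_space UNIV) (\<lambda>\<omega>. (Xs l \<omega>, Ys l \<omega>)) =
                      distr M (borel \<Otimes>\<^sub>M count_space UNIV) (\<lambda>\<omega>. (X \<omega>, Y \<omega>))"
    and density: "real_density_of M X f"
    and class_density: "\<forall>i\<in>{1..Q}. class_density_of M X Y i (fc i)"
    and posterior: "\<forall>i\<in>{1..Q}. class_posterior_of M X Y i (\<eta> i)"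
    and A1: "0 < fmin" "\<forall>x\<in>S. fmin \<le> f x \<and> f x \<le> fmax"
    and C1: "\<forall>i\<in>{1..Q}. 0 < fcmin i \<and> (\<forall>x\<in>S. fcmin i \<le> fc i x \<and> fc i x \<le> fcmax i)"
    and C2: "0 < \<gamma>"
      "\<forall>i\<in>{1..Q}. \<forall>x\<in>S. \<forall>y\<in>S. \<bar>fc i x - fc i y\<bar> \<le> c i * norm (x - y) powr \<gamma>"
    and B: "bandwidth_condition CARD('d) \<gamma> h"
    and hs: "hs \<longlonglongrightarrow> 0" "d0 < 1 / (2 * real CARD('d))" "\<forall>n\<ge>1. real n powr (- d0) \<le> hs n"
  shows "AE \<omega> in M.
    (\<lambda>n. soft_nn_risk M X Q \<eta> (\<lambda>l. Xs l \<omega>) (\<lambda>l. Ys l \<omega>) n (hs n) -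
         (1 / (real n)\<^sup>2) *
           (\<Sum>l=1..n. \<Sum>m=l+1..n. theta (\<lambda>l. Ys l \<omega>) l m * pair_weight (\<lambda>l. Xs l \<omega>) n (h n) l m))
    \<longlonglongrightarrow> 0"
proof -
  interpret prob_space M by fact
  note [measurable] = assms(2,3)
  have \<eta>_borel: "\<eta> j \<in> borel_measurable borel" if "j \<in> {1..Q}" for j
    using posterior that by (auto simp: class_posterior_of_def)
  have range: "AE \<omega> in M. 0 \<le> \<eta> j (X \<omega>) \<and> \<eta> j (X \<omega>) \<le> 1" if "j \<in> {1..Q}" for j
    using posterior that by (intro class_posterior_range[OF assms(2,3)]) auto
  \<comment> \<open>Truncation makes the range condition hold everywhere; indices outside
    \<open>{1..Q}\<close>, about which nothing is known, get the zero function.\<close>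
  define \<eta>' where "\<eta>' j = (if j \<in> {1..Q} then (\<lambda>x. max 0 (min 1 (\<eta> j x))) else (\<lambda>_. 0))" for j
  have \<eta>'_measurable[measurable]: "\<eta>' j \<in> borel_measurable borel" for j
    unfolding \<eta>'_def using \<eta>_borel[of j] by (cases "j \<in> {1..Q}") simp_all
  have eq: "AE \<omega> in M. \<eta> j (X \<omega>) = \<eta>' j (X \<omega>)" if "j \<in> {1..Q}" for j
    using range[OF that] by eventually_elim (use that in \<open>auto simp: \<eta>'_def\<close>)
  interpret labelled_sample M X Y Xs Ys Q f \<eta>' fmin fmax
  proof unfold_locales
    show "AE \<omega> in M. fmin \<le> f (X \<omega>) \<and> f (X \<omega>) \<le> fmax"
      using assms(5) by eventually_elim (use A1 in auto)
    show "0 \<le> \<eta>' j x \<and> \<eta>' j x \<le> 1" for j x by (simp add: \<eta>'_def)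
    show "expectation (\<lambda>\<omega>. k (X \<omega>) * of_bool (Y \<omega> = j)) = expectation (\<lambda>\<omega>. k (X \<omega>) * \<eta>' j (X \<omega>))"
      if j: "j \<in> {1..Q}" and [measurable]: "k \<in> borel_measurable borel" and "\<And>x. \<bar>k x\<bar> \<le> b" for j k b
    proof -
      note [measurable] = \<eta>_borel[OF j]
      have "expectation (\<lambda>\<omega>. k (X \<omega>) * of_bool (Y \<omega> = j)) = expectation (\<lambda>\<omega>. k (X \<omega>) * \<eta> j (X \<omega>))"
        using posterior that by (intro class_posterior_expectation[OF assms(2,3)]) auto
      also have "\<dots> = expectation (\<lambda>\<omega>. k (X \<omega>) * \<eta>' j (X \<omega>))"
        by (rule integral_cong_AE) (use eq[OF j] in \<open>auto elim!: eventually_mono\<close>)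
      finally show ?thesis .
    qed
  qed (use assms(2,3,6) iid_indep iid_copies density A1(1) in \<open>auto simp: real_density_of_def\<close>)
  \<comment> \<open>Truncation leaves the risk unchanged, since the posterior enters only as a
    factor evaluated at \<open>X\<close>, where both versions agree almost surely.\<close>
  have risk: "soft_nn_risk M X Q \<eta> x y n k = soft_nn_risk M X Q \<eta>' x y n k" for x y n k
    unfolding soft_nn_risk_def
  proof (intro sum.cong refl integral_cong_AE)
    fix i j assume "i \<in> {1..Q}"
    note [measurable] = \<eta>_borel[OF this]
    have [measurable]: "(\<lambda>u. soft_nn x y n k u j) \<in> borel_measurable borel"
      unfolding soft_nn_def by measurable
    show "(\<lambda>\<omega>. \<eta> i (X \<omega>) * soft_nn x y n k (X \<omega>) j) \<in> borel_measurable M"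
      "(\<lambda>\<omega>. \<eta>' i (X \<omega>) * soft_nn x y n k (X \<omega>) j) \<in> borel_measurable M" by measurable
    show "AE \<omega> in M. \<eta> i (X \<omega>) * soft_nn x y n k (X \<omega>) j = \<eta>' i (X \<omega>) * soft_nn x y n k (X \<omega>) j"
      using eq[OF \<open>i \<in> {1..Q}\<close>] by eventually_elim simp
  qed
  have "eventually (\<lambda>n. 0 < hs n) sequentially"
    using eventually_ge_at_top[of 1]
  proof eventually_elim
    case (elim n)
    then have "0 < real n powr (- d0)" by simp
    then show ?case using hs(3)[rule_format, OF elim] by linarith
  qed
  \<comment> \<open>The assumption on \<open>d0\<close> even makes this exponent larger than
    1/2.\<close>
  moreover have "0 < 1 - d0 * CARD('d)" using hs(2) by (simp add: field_simps)
  ultimately have "AE \<omega> in M. (\<lambda>n. soft_nn_risk M X Q \<eta> (\<lambda>l. Xs l \<omega>) (\<lambda>l. Ys l \<omega>) n (hs n)) \<longlonglongrightarrow> risk_limit"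
    unfolding risk using powr_bandwidth_lower_bound[OF hs(3)] by (intro soft_nn_risk_tendsto hs(1))
  moreover have "AE \<omega> in M. (\<lambda>n. (1 / (real n)\<^sup>2) *
      (\<Sum>l=1..n. \<Sum>m=l+1..n. theta (\<lambda>l. Ys l \<omega>) l m * pair_weight (\<lambda>l. Xs l \<omega>) n (h n) l m)) \<longlonglongrightarrow> risk_limit"
  proof (rule pair_sum_tendsto)
    show "eventually (\<lambda>n. 0 < h n) sequentially" "h \<longlonglongrightarrow> 0"
      using B by (auto simp: bandwidth_condition_def eventually_sequentially)
    show "0 < 2 * \<gamma> / (real CARD('d) + 2 * \<gamma>)" using C2(1) by (simp add: add_nonneg_pos)
    show "eventually (\<lambda>n. real n powr (2 * \<gamma> / (real CARD('d) + 2 * \<gamma>)) \<le> n * h n ^ CARD('d)) sequentially"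
      using bandwidth_condition_lower_bound[OF B C2(1)] by simp
  qed
  ultimately show ?thesis
  proof eventually_elim
    case (elim \<omega>)
    then show ?case using tendsto_diff[OF elim] by simp
  qed
qed

end
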